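(* Let $\epsilon,\delta,\eta,\nu>0$ and set $r=\frac{8\ln(2/\nu)}{\eta^2}$ and $w=\frac{\sqrt{32r\ln(2/\delta)}}{\epsilon}\ln(4r/\delta)$; assume $n$ is such that $\frac{w}{n}<\frac12$ and $\frac1w<\frac12$. Consider the following randomized algorithm (Algorithm 1) whose input is an undirected graph $G$ on $n$ vertices with edge weights $w_{u,v}\in[0,1]$ (weight $0$ meaning no edge): (1) for every pair $u\neq v$, replace $w_{u,v}$ by $\frac wn+\left(1-\frac wn\right)w_{u,v}$, obtaining a graph $H$; (2) pick an $r\times\binom n2$ matrix $M$ whose entries are i.i.d. samples of $\mathcal N(0,1)$; (3) output $\tilde L=\frac1r E_H^{\mathsf T}M^{\mathsf T}ME_H$, where $E_H$ is the edge matrix of $H$. Then this algorithm preserves $(\epsilon,\delta)$-differential privacy with respect to edge changes, i.e. for every pair of neighboring graphs $G,G'$ and every measurable set $\mathcal S$ of possible outputs, $\Pr[\mathrm{ALG}(G)\in\mathcal S]\le e^{\epsilon}\Pr[\mathrm{ALG}(G')\in\mathcal S]+\delta$.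
   Context: Two weighted $n$-vertex graphs (edge weights in $[0,1]$) are neighbors if they differ only in the weight of a single pair $(a,b)$. The edge matrix $E_G$ of a weighted graph $G$ on vertices ordered arbitrarily is the $\binom n2\times n$ matrix with one row for each pair $\{u,v\}$, $u<v$, whose entries are $(E_G)_{(\{u,v\},x)}=\sqrt{w_{u,v}}$ if $x=u$, $-\sqrt{w_{u,v}}$ if $x=v$, and $0$ otherwise. Its Laplacian is $L_G=E_G^{\mathsf T}E_G$.
   Formalization: The formal theorem adds the assumption ε ≤ 16 ln(2/δ) ln(4r/δ)², since without an upper bound on ε the claim fails (e.g. δ=1/2, r=n=10⁶, w=2.1), and takes r to be 8 ln(2/ν)/η² rounded up to an integer. *)

theory Defs
  imports "HOL-Probability.Probability"
begin

type_synonym 'n weighting = "'n \<Rightarrow> 'n \<Rightarrow> real"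
type_synonym 'n square_matrix = "real^'n^'n"

definition weighted_graph :: "'n weighting \<Rightarrow> bool" where
  "weighted_graph W \<longleftrightarrow>
     (\<forall>u v. W u v = W v u) \<and> (\<forall>u. W u u = 0) \<and> (\<forall>u v. 0 \<le> W u v \<and> W u v \<le> 1)"

definition neighbouring :: "'n weighting \<Rightarrow> 'n weighting \<Rightarrow> bool" where
  "neighbouring W W' \<longleftrightarrow> weighted_graph W \<and> weighted_graph W' \<and>
     (\<exists>a b. a \<noteq> b \<and> (\<forall>u v. {u, v} \<noteq> {a, b} \<longrightarrow> W u v = W' u v))"

definition vertex_pairs :: "('n::linorder \<times> 'n) set" where
  "vertex_pairs = {(u, v). u < v}"

text \<open>Matrices are functions of a row and a column index; the row and column index sets are explicit,
  since neither the number \<^term>\<open>r\<close> of rows of the random matrix nor \<^term>\<open>vertex_pairs\<close> is a type.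
  In \<open>mat_prod K A B\<close> the set \<open>K\<close> indexes the columns of \<open>A\<close> and the rows of \<open>B\<close>.\<close>

definition mat_prod :: "'k set \<Rightarrow> ('i \<Rightarrow> 'k \<Rightarrow> real) \<Rightarrow> ('k \<Rightarrow> 'j \<Rightarrow> real) \<Rightarrow> 'i \<Rightarrow> 'j \<Rightarrow> real" where
  "mat_prod K A B = (\<lambda>i j. \<Sum>k\<in>K. A i k * B k j)"

definition mat_transpose :: "('i \<Rightarrow> 'j \<Rightarrow> real) \<Rightarrow> 'j \<Rightarrow> 'i \<Rightarrow> real" where
  "mat_transpose A = (\<lambda>j i. A i j)"

definition edge_matrix :: "'n weighting \<Rightarrow> 'n \<times> 'n \<Rightarrow> 'n \<Rightarrow> real" where
  "edge_matrix W = (\<lambda>(u, v) x. if x = u then sqrt (W u v) else if x = v then - sqrt (W u v) else 0)"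

definition reweight :: "real \<Rightarrow> 'n::finite weighting \<Rightarrow> 'n weighting" where
  "reweight w W = (\<lambda>u v. if u = v then 0
     else w / real CARD('n) + (1 - w / real CARD('n)) * W u v)"

definition gaussian_matrix :: "nat \<Rightarrow> (nat \<times> 'n::linorder \<times> 'n \<Rightarrow> real) measure" where
  "gaussian_matrix r = PiM ({..<r} \<times> vertex_pairs) (\<lambda>_. std_normal_distribution)"

definition sketched_laplacian ::
    "nat \<Rightarrow> 'n weighting \<Rightarrow> (nat \<Rightarrow> 'n \<times> 'n \<Rightarrow> real) \<Rightarrow> 'n::{finite,linorder} square_matrix" where
  "sketched_laplacian r H M = (\<chi> x y. 1 / real r *
     mat_prod vertex_pairs (mat_transpose (edge_matrix H))
       (mat_prod {..<r} (mat_transpose M) (mat_prod vertex_pairs M (edge_matrix H))) x y)"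

text \<open>The output distribution of the algorithm on the input graph \<open>W\<close>.\<close>

definition jl_laplacian :: "nat \<Rightarrow> real \<Rightarrow> 'n weighting \<Rightarrow> 'n::{finite,linorder} square_matrix measure" where
  "jl_laplacian r w W =
     distr (gaussian_matrix r) borel (\<lambda>M. sketched_laplacian r (reweight w W) (curry M))"

definition differentially_private ::
    "('g \<Rightarrow> 'g \<Rightarrow> bool) \<Rightarrow> real \<Rightarrow> real \<Rightarrow> ('g \<Rightarrow> 'o::topological_space measure) \<Rightarrow> bool" where
  "differentially_private nbr \<epsilon> \<delta> alg \<longleftrightarrow>
     (\<forall>G G'. nbr G G' \<longrightarrow> (\<forall>S\<in>sets borel.
        measure (alg G) S \<le> exp \<epsilon> * measure (alg G') S + \<delta>))"

text \<open>Since \<^const>\<open>distr\<close> of a non-measurable map is degenerate, we record that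
  \<^const>\<open>jl_laplacian\<close> is a probability distribution on the Borel sets.\<close>

lemma sketched_laplacian_measurable [measurable]:
  fixes H :: "'n::{finite,linorder} weighting"
  shows "(\<lambda>M. sketched_laplacian r H (curry M)) \<in> gaussian_matrix r \<rightarrow>\<^sub>M borel"
proof -
  have comp: "(\<lambda>M. M (i, p)) \<in> borel_measurable (gaussian_matrix r)"
    if "i < r" "p \<in> vertex_pairs" for i and p :: "'n \<times> 'n"
  proof -
    have "(\<lambda>M. M (i, p)) \<in> gaussian_matrix r \<rightarrow>\<^sub>M std_normal_distribution"
      unfolding gaussian_matrix_def by (rule measurable_component_singleton) (use that in auto)
    then show ?thesis by simp
  qed
  have "(\<lambda>M. sketched_laplacian r H (curry M) $ x $ y) \<in> borel_measurable (gaussian_matrix r)" for x y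
    unfolding sketched_laplacian_def mat_prod_def mat_transpose_def curry_def vec_lambda_beta
    by (intro borel_measurable_times borel_measurable_sum borel_measurable_const comp) auto
  then show ?thesis
    by (intro borel_measurable_euclidean_space[THEN iffD2])
       (auto simp: Basis_vec_def inner_axis)
qed

lemma prob_space_jl_laplacian: "prob_space (jl_laplacian r w W)"
  unfolding jl_laplacian_def
proof (rule prob_space.prob_space_distr)
  show "prob_space (gaussian_matrix r :: (nat \<times> 'n::{finite,linorder} \<times> 'n \<Rightarrow> real) measure)"
    unfolding gaussian_matrix_def
    by (intro prob_space_PiM prob_space_normal_density) simp
qed measurable

text \<open>Privacy of \<^const>\<open>jl_laplacian\<close> needs some upper bound on \<open>\<epsilon>\<close>: with the noise level
  \<open>w = sqrt (32 * r * ln (2 / \<delta>)) / \<epsilon> * ln (4 * r / \<delta>)\<close> kept just above 2 and \<open>r\<close> large, the privacy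
  loss concentrates around a multiple of \<open>r\<close>, whereas \<open>\<epsilon>\<close> only grows like \<open>sqrt r * ln r\<close>.
  The bound \<open>\<epsilon> \<le> 16 * ln (2 / \<delta>) * (ln (4 * r / \<delta>))\<^sup>2\<close>, equivalently \<open>2 * r \<le> \<epsilon> * w\<^sup>2\<close>, rules this out;
  for \<open>\<delta> < 1 \<le> r\<close> it holds whenever \<open>\<epsilon> \<le> 21\<close>.\<close>

end

theory Submission
  imports Defs
begin

text \<open>Let \<open>b\<close> be the difference of the basis vectors of the endpoints of the changed pair. Each row of
  \<open>M E\<^sub>H\<close> is a centred Gaussian vector with covariance \<open>L\<^sub>H\<close>. Rotating the independent Gaussian
  entries by the series and parallel laws for conductances turns it into \<open>V + sqrt \<kappa> g b\<close> with \<open>g\<close> standard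
  normal, \<open>V\<close> independent of \<open>g\<close> and unaffected by the weight of the changed pair, and \<open>\<kappa> \<ge> w / 2\<close>, since every pair
  has weight at least \<open>w / n\<close>. Neighbouring graphs thus differ only in \<open>\<kappa>\<close>, and by at most 1, which reduces
  privacy to a comparison of the one-dimensional laws \<open>N(0, \<kappa>)\<close> and \<open>N(0, \<kappa>')\<close>, taken \<open>r\<close> times. If \<open>\<rho>\<close>
  is their likelihood ratio, then \<open>\<rho> \<le> exp \<epsilon> + exp (- t * \<epsilon>) * \<rho> powr (1 + t)\<close> for all \<open>t \<ge> 0\<close>, and
  for \<open>t = 3 * ln (1 / \<delta>) / \<epsilon>\<close> the last term integrates to at most \<open>\<delta>\<close>.\<close>

section \<open>Rotation invariance of Gaussian arrays\<close>

text \<open>The rotation is split into two one-dimensional affine substitutions, one per variable,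
  with Fubini in between. The Jacobians \<bar>1 / c\<bar> and \<bar>c\<bar> cancel; c \<noteq> 0
  makes both substitutions possible.\<close>

lemma nn_integral_lborel_rotation:
  fixes F :: "real \<Rightarrow> real \<Rightarrow> ennreal" and c s :: real
  assumes [measurable]: "case_prod F \<in> borel_measurable (borel \<Otimes>\<^sub>M borel)"
    and cs: "c\<^sup>2 + s\<^sup>2 = 1" "c \<noteq> 0"
  shows "(\<integral>\<^sup>+y. \<integral>\<^sup>+x. F (c * y - s * x) (s * y + c * x) \<partial>lborel \<partial>lborel) = (\<integral>\<^sup>+y. \<integral>\<^sup>+x. F y x \<partial>lborel \<partial>lborel)"
proof -
  have "(\<integral>\<^sup>+y. \<integral>\<^sup>+x. F (c * y - s * x) (s * y + c * x) \<partial>lborel \<partial>lborel)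
      = (\<integral>\<^sup>+x. \<integral>\<^sup>+y. F (c * y - s * x) (s * y + c * x) \<partial>lborel \<partial>lborel)"
    by (rule lborel_pair.Fubini') measurable
  also have "\<dots> = (\<integral>\<^sup>+x. ennreal \<bar>1 / c\<bar> * (\<integral>\<^sup>+u. F u ((s * u + x) / c) \<partial>lborel) \<partial>lborel)"
  proof (rule nn_integral_cong)
    fix x :: real
    \<comment> \<open>Solving u = c * y - s * x for y and using c^2 + s^2 = 1 collapses the second
      argument to (s * u + x) / c.\<close>
    have *: "s * (s * x / c + 1 / c * u) + c * x = (s * u + x) / c" for u
    proof -
      have "s * (s * x / c + 1 / c * u) + c * x = (s\<^sup>2 * x + c\<^sup>2 * x + s * u) / c"
        using cs(2) by (simp add: field_simps power2_eq_square)
      also have "s\<^sup>2 * x + c\<^sup>2 * x = x"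
        using cs(1) by (metis add.commute distrib_right mult_1)
      finally show ?thesis by (simp add: add.commute)
    qed
    have "(\<integral>\<^sup>+y. F (c * y - s * x) (s * y + c * x) \<partial>lborel) =
      ennreal \<bar>1 / c\<bar> * (\<integral>\<^sup>+u. F (c * (s * x / c + 1 / c * u) - s * x) (s * (s * x / c + 1 / c * u) + c * x) \<partial>lborel)"
      using cs(2) by (intro nn_integral_real_affine) auto
    also have "\<dots> = ennreal \<bar>1 / c\<bar> * (\<integral>\<^sup>+u. F u ((s * u + x) / c) \<partial>lborel)"
      unfolding * using cs(2) by (simp add: distrib_left)
    finally show "(\<integral>\<^sup>+y. F (c * y - s * x) (s * y + c * x) \<partial>lborel) = \<dots>" .
  qed
  also have "\<dots> = ennreal \<bar>1 / c\<bar> * (\<integral>\<^sup>+x. \<integral>\<^sup>+u. F u ((s * u + x) / c) \<partial>lborel \<partial>lborel)"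
    by (rule nn_integral_cmult) measurable
  also have "\<dots> = ennreal \<bar>1 / c\<bar> * (\<integral>\<^sup>+u. \<integral>\<^sup>+x. F u ((s * u + x) / c) \<partial>lborel \<partial>lborel)"
    by (subst lborel_pair.Fubini') auto
  also have "\<dots> = (\<integral>\<^sup>+u. ennreal \<bar>1 / c\<bar> * (\<integral>\<^sup>+x. F u ((s * u + x) / c) \<partial>lborel) \<partial>lborel)"
    by (rule nn_integral_cmult[symmetric]) measurable
  also have "\<dots> = (\<integral>\<^sup>+u. \<integral>\<^sup>+x. F u x \<partial>lborel \<partial>lborel)"
  proof (rule nn_integral_cong)
    fix u :: real
    \<comment> \<open>The substitution x = - s * u + c * v turns the second argument into v.\<close>
    have "(\<integral>\<^sup>+x. F u ((s * u + x) / c) \<partial>lborel) =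
      ennreal \<bar>c\<bar> * (\<integral>\<^sup>+v. F u ((s * u + (- s * u + c * v)) / c) \<partial>lborel)"
      using cs(2) by (intro nn_integral_real_affine) auto
    then show "ennreal \<bar>1 / c\<bar> * (\<integral>\<^sup>+x. F u ((s * u + x) / c) \<partial>lborel) = (\<integral>\<^sup>+x. F u x \<partial>lborel)"
      using cs(2) by (simp add: mult.assoc[symmetric] ennreal_mult[symmetric])
  qed
  finally show ?thesis .
qed

lemma std_normal_density_mult:
  "std_normal_density y * std_normal_density x = 1 / (2 * pi) * exp (- (y\<^sup>2 + x\<^sup>2) / 2)"
proof -
  have "std_normal_density y * std_normal_density x
    = 1 / (sqrt (2 * pi) * sqrt (2 * pi)) * (exp (- y\<^sup>2 / 2) * exp (- x\<^sup>2 / 2))"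
    unfolding std_normal_density_def by (simp add: divide_divide_eq_left del: real_sqrt_mult_self)
  also have "exp (- y\<^sup>2 / 2) * exp (- x\<^sup>2 / 2) = exp (- (y\<^sup>2 + x\<^sup>2) / 2)"
    by (simp add: exp_add[symmetric] add_divide_distrib)
  finally show ?thesis by simp
qed

text \<open>The joint density \<open>D\<close> depends only on y^2 + x^2, which the rotation
  preserves, so the Lebesgue statement can be applied to \<open>D\<close> times
  \<open>F\<close>.\<close>

lemma nn_integral_std_normal_rotation:
  fixes F :: "real \<Rightarrow> real \<Rightarrow> ennreal" and c s :: real
  assumes [measurable]: "case_prod F \<in> borel_measurable (borel \<Otimes>\<^sub>M borel)"
    and cs: "c\<^sup>2 + s\<^sup>2 = 1" "c \<noteq> 0"
  shows "(\<integral>\<^sup>+y. \<integral>\<^sup>+x. F (c * y - s * x) (s * y + c * x) \<partial>std_normal_distribution \<partial>std_normal_distribution)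
    = (\<integral>\<^sup>+y. \<integral>\<^sup>+x. F y x \<partial>std_normal_distribution \<partial>std_normal_distribution)"
proof -
  define D where "D y x = ennreal (1 / (2 * pi) * exp (- (y\<^sup>2 + x\<^sup>2) / 2))" for y x :: real
  have D: "(\<integral>\<^sup>+y. \<integral>\<^sup>+x. G y x \<partial>std_normal_distribution \<partial>std_normal_distribution)
     = (\<integral>\<^sup>+y. \<integral>\<^sup>+x. D y x * G y x \<partial>lborel \<partial>lborel)"
    if [measurable]: "case_prod G \<in> borel_measurable (borel \<Otimes>\<^sub>M borel)" for G :: "real \<Rightarrow> real \<Rightarrow> ennreal"
  proof -
    have "ennreal (std_normal_density y) * (ennreal (std_normal_density x) * G y x) = D y x * G y x" for y x
      unfolding D_def std_normal_density_mult[symmetric] by (simp add: ennreal_mult mult.assoc)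
    then show ?thesis
      by (simp add: nn_integral_density nn_integral_cmult[symmetric])
  qed
  have inv: "(c * y - s * x)\<^sup>2 + (s * y + c * x)\<^sup>2 = y\<^sup>2 + x\<^sup>2" for x y
  proof -
    have "(c * y - s * x)\<^sup>2 + (s * y + c * x)\<^sup>2 = (c\<^sup>2 + s\<^sup>2) * (y\<^sup>2 + x\<^sup>2)"
      by (simp add: power2_eq_square algebra_simps)
    then show ?thesis using cs(1) by simp
  qed
  have [measurable]: "case_prod D \<in> borel_measurable (borel \<Otimes>\<^sub>M borel)"
    unfolding D_def by measurable
  have "(\<integral>\<^sup>+y. \<integral>\<^sup>+x. F (c * y - s * x) (s * y + c * x) \<partial>std_normal_distribution \<partial>std_normal_distribution)
      = (\<integral>\<^sup>+y. \<integral>\<^sup>+x. D (c * y - s * x) (s * y + c * x) * F (c * y - s * x) (s * y + c * x) \<partial>lborel \<partial>lborel)"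
    by (subst D) (measurable, simp add: D_def inv)
  also have "\<dots> = (\<integral>\<^sup>+y. \<integral>\<^sup>+x. D y x * F y x \<partial>lborel \<partial>lborel)"
    by (rule nn_integral_lborel_rotation[of "\<lambda>y x. D y x * F y x", OF _ cs]) measurable
  finally show ?thesis by (subst D) measurable
qed

abbreviation gaussian_array :: "'k set \<Rightarrow> ('k \<Rightarrow> real) measure" where
  "gaussian_array K \<equiv> PiM K (\<lambda>_. std_normal_distribution)"

definition givens :: "'k \<Rightarrow> 'k \<Rightarrow> real \<Rightarrow> real \<Rightarrow> ('k \<Rightarrow> real) \<Rightarrow> 'k \<Rightarrow> real" where
  "givens k l c s M = M(k := c * M k - s * M l, l := s * M k + c * M l)"

lemma measurable_givens [measurable]:
  assumes "k \<in> K" "l \<in> K"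
  shows "givens k l c s \<in> gaussian_array K \<rightarrow>\<^sub>M gaussian_array K"
proof -
  have comp: "(\<lambda>M. M i) \<in> borel_measurable (gaussian_array K)" if "i \<in> K" for i
    using measurable_component_singleton[OF that, of "\<lambda>_. std_normal_distribution"] by simp
  show ?thesis
    unfolding givens_def using assms
    by (intro measurable_fun_upd[where J = K]) (auto intro!: comp borel_measurable_diff borel_measurable_add borel_measurable_times)
qed

text \<open>Fubini puts the two rotated coordinates outermost, so that only planar invariance
  remains to be used; the other coordinates enter through the measure of a slice.\<close>

lemma distr_givens:
  assumes fin: "finite K" and kl: "k \<in> K" "l \<in> K" "k \<noteq> l"
    and cs: "c\<^sup>2 + s\<^sup>2 = 1" "c \<noteq> 0"
  shows "distr (gaussian_array K) (gaussian_array K) (givens k l c s)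
    = gaussian_array K"
proof -
  interpret N: prob_space std_normal_distribution by (rule prob_space_normal_density) simp
  interpret P: product_sigma_finite "\<lambda>_. std_normal_distribution" ..
  define J where "J = K - {k, l}"
  have K: "K = insert k (insert l J)" and J: "finite J" "k \<notin> insert l J" "l \<notin> J"
    using fin kl by (auto simp: J_def)
  let ?P = "gaussian_array K"
  have *: "integral\<^sup>N ?P F = (\<integral>\<^sup>+ y. \<integral>\<^sup>+ x. \<integral>\<^sup>+ z. F (z(l := x, k := y)) \<partial>(gaussian_array J)
      \<partial>std_normal_distribution \<partial>std_normal_distribution)" if [measurable]: "F \<in> borel_measurable ?P" for F
  proof -
    note [measurable] = that[unfolded K]
    show ?thesis
      unfolding K using J
      apply (subst P.product_nn_integral_insert_rev)
         apply (auto simp: K[symmetric])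
      apply (rule nn_integral_cong)
      apply (subst P.product_nn_integral_insert_rev)
         apply auto
      done
  qed
  show ?thesis
  proof (rule measure_eqI)
    fix A assume "A \<in> sets (distr ?P ?P (givens k l c s))"
    then have A[measurable]: "A \<in> sets ?P" by simp
    \<comment> \<open>\<open>G y x\<close> is the measure of the slice of \<open>A\<close> at which
      coordinate \<open>k\<close> is \<open>y\<close> and coordinate \<open>l\<close> is
      \<open>x\<close>.\<close>
    define G where "G y x = (\<integral>\<^sup>+ z. indicator A (z(l := x, k := y)) \<partial>(gaussian_array J))" for x y
    have [measurable]: "case_prod G \<in> borel_measurable (borel \<Otimes>\<^sub>M borel)"
    proof -
      have upd: "(\<lambda>p. (snd p)(l := snd (fst p), k := fst (fst p))) \<in>
          (borel \<Otimes>\<^sub>M borel) \<Otimes>\<^sub>M gaussian_array J \<rightarrow>\<^sub>M ?P"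
        unfolding K using J by (intro measurable_fun_upd[where J = "insert l J"] measurable_fun_upd[where J = J]) auto
      interpret PJ: sigma_finite_measure "gaussian_array J"
        using J by (intro P.sigma_finite) auto
      have "(\<lambda>p. indicator A ((snd p)(l := snd (fst p), k := fst (fst p)))) \<in>
          borel_measurable ((borel \<Otimes>\<^sub>M borel) \<Otimes>\<^sub>M gaussian_array J)"
        by (rule measurable_compose[OF upd]) measurable
      from PJ.borel_measurable_nn_integral_fst[OF this] show ?thesis
        by (simp add: G_def[abs_def] case_prod_unfold)
    qed
    have "emeasure (distr ?P ?P (givens k l c s)) A = (\<integral>\<^sup>+ M. indicator A (givens k l c s M) \<partial>?P)"
      using kl nn_integral_distr[of "givens k l c s" ?P ?P "indicator A"] by simp
    also have "\<dots> = (\<integral>\<^sup>+y. \<integral>\<^sup>+x. G (c * y - s * x) (s * y + c * x) \<partial>std_normal_distribution \<partial>std_normal_distribution)"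
      using measurable_compose[OF measurable_givens, OF kl(1,2) borel_measurable_indicator[OF A]] kl
      by (subst *) (auto simp: G_def givens_def fun_upd_twist intro!: nn_integral_cong)
    also have "\<dots> = (\<integral>\<^sup>+y. \<integral>\<^sup>+x. G y x \<partial>std_normal_distribution \<partial>std_normal_distribution)"
      by (rule nn_integral_std_normal_rotation[OF _ cs]) measurable
    also have "\<dots> = (\<integral>\<^sup>+ M. indicator A M \<partial>?P)"
      unfolding G_def by (rule *[symmetric]) measurable
    finally show "emeasure (distr ?P ?P (givens k l c s)) A = emeasure ?P A" by simp
  qed simp
qed

section \<open>Likelihood ratios of product measures\<close>

text \<open>Both sides agree on boxes with the product measure whose factors are the transformed
  \<open>M i\<close>, and a finite product of probability measures is determined by its values on
  boxes.\<close>

lemma distr_PiM_eq_density: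
  fixes M :: "'i \<Rightarrow> 'a measure"
  assumes fin: "finite I" and prob: "\<And>i. prob_space (M i)"
    and f: "\<And>i. i \<in> I \<Longrightarrow> f i \<in> M i \<rightarrow>\<^sub>M M i"
    and g: "\<And>i. i \<in> I \<Longrightarrow> g i \<in> borel_measurable (M i)"
    and eq: "\<And>i. i \<in> I \<Longrightarrow> distr (M i) (M i) (f i) = density (M i) (g i)"
  shows "distr (PiM I M) (PiM I M) (\<lambda>x. \<lambda>i\<in>I. f i (x i)) = density (PiM I M) (\<lambda>x. \<Prod>i\<in>I. g i (x i))"
proof -
  \<comment> \<open>Outside \<open>I\<close> the factor stays \<open>M i\<close>, so that every
    \<open>N i\<close> is a probability space, as the product locale demands.\<close>
  define N where "N i = (if i \<in> I then density (M i) (g i) else M i)" for i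
  have N: "prob_space (N i)" for i
    using prob_space.prob_space_distr[OF prob f] by (auto simp: N_def prob eq[symmetric])
  interpret M: product_prob_space M by (rule product_prob_spaceI) (rule prob)
  interpret N: product_prob_space N by (rule product_prob_spaceI) (rule N)
  have sets: "sets (PiM I N) = sets (PiM I M)"
    by (intro sets_PiM_cong) (auto simp: N_def)
  note [measurable] = f g
  have meas: "(\<lambda>x. \<lambda>i\<in>I. f i (x i)) \<in> PiM I M \<rightarrow>\<^sub>M PiM I M"
    by (intro measurable_restrict measurable_compose[OF measurable_component_singleton] f)
  have "distr (PiM I M) (PiM I M) (\<lambda>x. \<lambda>i\<in>I. f i (x i)) = PiM I N"
  proof (rule N.PiM_eqI[OF fin])
    fix A assume "\<And>i. i \<in> I \<Longrightarrow> A i \<in> sets (N i)"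
    then have A: "A i \<in> sets (M i)" if "i \<in> I" for i using that by (auto simp: N_def)
    have "emeasure (distr (PiM I M) (PiM I M) (\<lambda>x. \<lambda>i\<in>I. f i (x i))) (Pi\<^sub>E I A)
        = emeasure (PiM I M) (Pi\<^sub>E I (\<lambda>i. f i -` A i \<inter> space (M i)))"
      using A by (subst emeasure_distr[OF meas])
        (auto intro!: sets_PiM_I_finite fin arg_cong2[where f = emeasure] simp: space_PiM PiE_iff)
    also have "\<dots> = (\<Prod>i\<in>I. emeasure (N i) (A i))"
      using A by (subst M.emeasure_PiM[OF fin])
        (auto intro!: prod.cong simp: N_def emeasure_distr f eq[symmetric] measurable_sets[OF f])
    finally show "emeasure (distr (PiM I M) (PiM I M) (\<lambda>x. \<lambda>i\<in>I. f i (x i))) (Pi\<^sub>E I A)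
        = (\<Prod>i\<in>I. emeasure (N i) (A i))" .
  qed (simp add: sets)
  moreover have "density (PiM I M) (\<lambda>x. \<Prod>i\<in>I. g i (x i)) = PiM I N"
  proof (rule N.PiM_eqI[OF fin])
    fix A assume "\<And>i. i \<in> I \<Longrightarrow> A i \<in> sets (N i)"
    then have A[measurable]: "i \<in> I \<Longrightarrow> A i \<in> sets (M i)" for i by (auto simp: N_def)
    have [measurable]: "(\<lambda>x. \<Prod>i\<in>I. g i (x i)) \<in> borel_measurable (PiM I M)"
      by (intro borel_measurable_prod_ennreal measurable_compose[OF measurable_component_singleton] g)
    have "emeasure (density (PiM I M) (\<lambda>x. \<Prod>i\<in>I. g i (x i))) (Pi\<^sub>E I A)
       = (\<integral>\<^sup>+x. (\<Prod>i\<in>I. g i (x i)) * indicator (Pi\<^sub>E I A) x \<partial>PiM I M)"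
      using fin by (intro emeasure_density sets_PiM_I_finite A) measurable
    also have "\<dots> = (\<integral>\<^sup>+x. (\<Prod>i\<in>I. g i (x i) * indicator (A i) (x i)) \<partial>PiM I M)"
    proof (rule nn_integral_cong)
      fix x assume "x \<in> space (PiM I M)"
      then have "x \<in> Pi\<^sub>E I A \<longleftrightarrow> (\<forall>i\<in>I. x i \<in> A i)" by (auto simp: space_PiM PiE_iff)
      then show "(\<Prod>i\<in>I. g i (x i)) * indicator (Pi\<^sub>E I A) x = (\<Prod>i\<in>I. g i (x i) * indicator (A i) (x i))"
        using fin by (auto simp: prod.distrib indicator_def prod_zero_iff)
    qed
    also have "\<dots> = (\<Prod>i\<in>I. \<integral>\<^sup>+x. g i x * indicator (A i) x \<partial>M i)"
      by (rule M.product_nn_integral_prod[OF fin]) measurable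
    also have "\<dots> = (\<Prod>i\<in>I. emeasure (N i) (A i))"
      by (intro prod.cong) (auto simp: N_def emeasure_density)
    finally show "emeasure (density (PiM I M) (\<lambda>x. \<Prod>i\<in>I. g i (x i))) (Pi\<^sub>E I A)
        = (\<Prod>i\<in>I. emeasure (N i) (A i))" .
  qed (simp add: sets)
  ultimately show ?thesis by simp
qed

text \<open>A pointwise Chernoff bound: where p / q exceeds exp \<epsilon>, the factor (p / q) powr
  t is at least exp (t * \<epsilon>), so the second summand alone dominates p; elsewhere the first
  one does.\<close>

lemma le_scaled_plus_powr_ratio:
  fixes p q \<epsilon> t :: real
  assumes "0 < p" "0 < q" "0 \<le> t"
  shows "p \<le> exp \<epsilon> * q + exp (- t * \<epsilon>) * (p * (p / q) powr t)"
proof (cases "p \<le> exp \<epsilon> * q")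
  case False
  then have "exp \<epsilon> \<le> p / q" using assms by (simp add: field_simps)
  then have "exp \<epsilon> powr t \<le> (p / q) powr t" using assms by (intro powr_mono2) auto
  then have "1 \<le> exp (- t * \<epsilon>) * (p / q) powr t"
    by (simp add: exp_powr_real exp_minus field_simps)
  then have "p * 1 \<le> p * (exp (- t * \<epsilon>) * (p / q) powr t)"
    using assms by (intro mult_left_mono) auto
  moreover have "0 \<le> exp \<epsilon> * q" using assms by simp
  ultimately show ?thesis by (simp add: mult_ac)
qed (use assms in \<open>simp add: add_increasing2\<close>)

text \<open>The pointwise bound for the product densities is integrated, over \<open>A\<close> in
  the first summand and over the whole space in the second. The second integrand is itself a product
  over coordinates, so its integral factors.\<close>

lemma emeasure_prod_density_le:
  fixes p q :: "'i \<Rightarrow> 'a \<Rightarrow> real"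
  assumes fin: "finite I" and prob: "\<And>i. prob_space (M i)" and "0 \<le> t"
    and p: "\<And>i. i \<in> I \<Longrightarrow> p i \<in> borel_measurable (M i)" "\<And>i x. 0 < p i x"
    and q: "\<And>i. i \<in> I \<Longrightarrow> q i \<in> borel_measurable (M i)" "\<And>i x. 0 < q i x"
    and A[measurable]: "A \<in> sets (PiM I M)"
  shows "emeasure (density (PiM I M) (\<lambda>x. \<Prod>i\<in>I. ennreal (p i (x i)))) A
    \<le> exp \<epsilon> * emeasure (density (PiM I M) (\<lambda>x. \<Prod>i\<in>I. ennreal (q i (x i)))) A
      + exp (- t * \<epsilon>) * (\<Prod>i\<in>I. \<integral>\<^sup>+x. p i x * (p i x / q i x) powr t \<partial>M i)"
proof -
  interpret M: product_prob_space M by (rule product_prob_spaceI) (rule prob)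
  define P where "P x = (\<Prod>i\<in>I. p i (x i))" for x
  define Q where "Q x = (\<Prod>i\<in>I. q i (x i))" for x
  define R where "R i x = p i x * (p i x / q i x) powr t" for i x
  note [measurable] = p(1) q(1)
  have [measurable]: "P \<in> borel_measurable (PiM I M)" "Q \<in> borel_measurable (PiM I M)"
    unfolding P_def Q_def
    by (intro borel_measurable_prod measurable_compose[OF measurable_component_singleton] p q; simp)+
  have [measurable]: "i \<in> I \<Longrightarrow> R i \<in> borel_measurable (M i)" for i
    unfolding R_def by measurable
  have pos: "0 < P x" "0 < Q x" for x by (simp_all add: P_def Q_def p q prod_pos)
  have R: "(\<Prod>i\<in>I. R i (x i)) = P x * (P x / Q x) powr t" for x
    by (simp add: R_def P_def Q_def prod.distrib prod_dividef[symmetric] prod_powr_distrib p q less_imp_le)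
  have Rprod: "(\<Prod>i\<in>I. ennreal (R i (x i))) = ennreal (P x * (P x / Q x) powr t)" for x
    by (subst prod_ennreal) (use R[of x] p(2) in \<open>auto simp: R_def less_imp_le\<close>)
  have "emeasure (density (PiM I M) (\<lambda>x. \<Prod>i\<in>I. ennreal (p i (x i)))) A = (\<integral>\<^sup>+x. ennreal (P x) * indicator A x \<partial>PiM I M)"
    by (simp add: prod_ennreal p less_imp_le P_def[symmetric] emeasure_density)
  also have "\<dots> \<le> (\<integral>\<^sup>+x. exp \<epsilon> * (ennreal (Q x) * indicator A x) + exp (- t * \<epsilon>) * (\<Prod>i\<in>I. ennreal (R i (x i))) \<partial>PiM I M)"
  proof (rule nn_integral_mono)
    fix x
    have "ennreal (P x) \<le> ennreal (exp \<epsilon> * Q x + exp (- t * \<epsilon>) * (P x * (P x / Q x) powr t))"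
      by (intro ennreal_leI le_scaled_plus_powr_ratio pos) fact
    then show "ennreal (P x) * indicator A x \<le> ennreal (exp \<epsilon>) * (ennreal (Q x) * indicator A x)
        + ennreal (exp (- t * \<epsilon>)) * (\<Prod>i\<in>I. ennreal (R i (x i)))"
      using pos[of x] by (auto simp: indicator_def Rprod ennreal_mult ennreal_plus)
  qed
  also have "\<dots> = exp \<epsilon> * (\<integral>\<^sup>+x. ennreal (Q x) * indicator A x \<partial>PiM I M)
      + exp (- t * \<epsilon>) * (\<integral>\<^sup>+x. (\<Prod>i\<in>I. ennreal (R i (x i))) \<partial>PiM I M)"
  proof -
    have [measurable]: "(\<lambda>x. \<Prod>i\<in>I. ennreal (R i (x i))) \<in> borel_measurable (PiM I M)"
      by (intro borel_measurable_prod_ennreal measurable_ennreal measurable_compose[OF measurable_component_singleton]) auto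
    show ?thesis by (simp add: nn_integral_add nn_integral_cmult)
  qed
  also have "(\<integral>\<^sup>+x. (\<Prod>i\<in>I. ennreal (R i (x i))) \<partial>PiM I M) = (\<Prod>i\<in>I. \<integral>\<^sup>+x. R i x \<partial>M i)"
    by (rule M.product_nn_integral_prod[OF fin]) measurable
  also have "(\<integral>\<^sup>+x. ennreal (Q x) * indicator A x \<partial>PiM I M) = emeasure (density (PiM I M) (\<lambda>x. \<Prod>i\<in>I. ennreal (q i (x i)))) A"
    by (simp add: prod_ennreal q less_imp_le Q_def[symmetric] emeasure_density)
  finally show ?thesis unfolding R_def .
qed

section \<open>Gaussian likelihood ratios and the privacy exponent\<close>

text \<open>The difference of the two sides vanishes at 0 and has derivative y * (1 - 2 * y) / (1 -
  y), nonnegative up to 1 / 2.\<close>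

lemma ln_one_minus_ge_quadratic:
  fixes x :: real
  assumes "0 \<le> x" "x \<le> 1 / 2"
  shows "- x - x\<^sup>2 \<le> ln (1 - x)"
proof -
  have "0 \<le> ln (1 - x) + x + x\<^sup>2"
  proof (rule DERIV_nonneg_imp_nondecreasing[of 0 x "\<lambda>x. ln (1 - x) + x + x\<^sup>2", simplified])
    fix y :: real assume y: "0 \<le> y" "y \<le> x"
    then show "\<exists>D. ((\<lambda>x. ln (1 - x) + x + x\<^sup>2) has_real_derivative D) (at y) \<and> 0 \<le> D"
      using assms mult_nonneg_nonneg[of y "1 - 2 * y"]
      by (intro exI[of _ "- 1 / (1 - y) + 1 + 2 * y"] conjI)
        (auto intro!: derivative_eq_intros simp: field_simps)
  qed (use assms in auto)
  then show ?thesis by simp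
qed

lemma ln_one_plus_ge_quadratic:
  fixes x :: real
  assumes "0 \<le> x"
  shows "x - x\<^sup>2 / 2 \<le> ln (1 + x)"
proof -
  have "0 \<le> ln (1 + x) - x + x\<^sup>2 / 2"
  proof (rule DERIV_nonneg_imp_nondecreasing[of 0 x "\<lambda>x. ln (1 + x) - x + x\<^sup>2 / 2", simplified])
    fix y :: real assume y: "0 \<le> y" "y \<le> x"
    then show "\<exists>D. ((\<lambda>x. ln (1 + x) - x + x\<^sup>2 / 2) has_real_derivative D) (at y) \<and> 0 \<le> D"
      by (intro exI[of _ "1 / (1 + y) - 1 + y"] conjI)
        (auto intro!: derivative_eq_intros simp: field_simps)
  qed (use assms in auto)
  then show ?thesis by simp
qed

text \<open>The leading term is u / (1 + u) rather than u because for u = \<kappa>' / \<kappa> - 1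
  it equals 1 - \<kappa> / \<kappa>', the quantity in which the Renyi exponent is expanded.\<close>

lemma ln_one_plus_le_quadratic:
  fixes u :: real
  assumes "0 \<le> u"
  shows "ln (1 + u) \<le> u / (1 + u) + u\<^sup>2 / 2"
proof -
  have "(\<lambda>u. u / (1 + u) + u\<^sup>2 / 2 - ln (1 + u)) 0 \<le> (\<lambda>u. u / (1 + u) + u\<^sup>2 / 2 - ln (1 + u)) u"
  proof (rule DERIV_nonneg_imp_nondecreasing[of 0 u "\<lambda>u. u / (1 + u) + u\<^sup>2 / 2 - ln (1 + u)"])
    fix y :: real assume y: "0 \<le> y" "y \<le> u"
    have "y / (1 + y)\<^sup>2 \<le> y / 1" using y by (intro divide_left_mono) auto
    moreover have "1 / (1 + y)\<^sup>2 + y - 1 / (1 + y) = y - y / (1 + y)\<^sup>2"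
      using y by (simp add: divide_simps) algebra
    ultimately show "\<exists>D. ((\<lambda>u. u / (1 + u) + u\<^sup>2 / 2 - ln (1 + u)) has_real_derivative D) (at y) \<and> 0 \<le> D"
      using y
      by (intro exI[of _ "1 / (1 + y)\<^sup>2 + y - 1 / (1 + y)"] conjI)
        (auto intro!: derivative_eq_intros simp: power2_eq_square)
  qed (use assms in auto)
  then show ?thesis by simp
qed

text \<open>This is the Renyi moment of order 1 + t of two centred normal laws. The integrand is a
  multiple \<open>C\<close> of the normal density of variance \<kappa> / D; positivity of
  \<open>D\<close> is what makes it integrable.\<close>

lemma nn_integral_normal_renyi:
  fixes \<kappa> \<kappa>' t :: real
  assumes "0 < \<kappa>" "0 < \<kappa>'" "0 < 1 + t * (1 - \<kappa> / \<kappa>')"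
  shows "(\<integral>\<^sup>+x. normal_density 0 (sqrt \<kappa>) x *
      (normal_density 0 (sqrt \<kappa>) x / normal_density 0 (sqrt \<kappa>') x) powr t \<partial>lborel)
    = ennreal (exp ((- ln (1 + t * (1 - \<kappa> / \<kappa>')) - t * ln (\<kappa> / \<kappa>')) / 2))"
proof -
  define D where "D = 1 + t * (1 - \<kappa> / \<kappa>')"
  define \<sigma> where "\<sigma> = sqrt (\<kappa> / D)"
  define C where "C = exp ((- ln D - t * ln (\<kappa> / \<kappa>')) / 2)"
  have D: "0 < D" using assms by (simp add: D_def)
  have \<sigma>: "0 < \<sigma>" "\<sigma>\<^sup>2 = \<kappa> / D" using D assms by (auto simp: \<sigma>_def)
  \<comment> \<open>Writing the density as a single exponential turns products, quotients and
    \<open>powr\<close> into linear algebra on exponents.\<close>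
  have n: "normal_density 0 (sqrt k) x = exp (- (ln (2 * pi) + ln k) / 2 - x\<^sup>2 / (2 * k))" if "0 < k" for k x :: real
  proof -
    have "sqrt (2 * pi * k) = exp ((ln (2 * pi) + ln k) / 2)"
    proof (rule real_sqrt_unique)
      have "(exp ((ln (2 * pi) + ln k) / 2))\<^sup>2 = exp (ln (2 * pi) + ln k)"
        by (simp only: power2_eq_square exp_add[symmetric] field_sum_of_halves)
      then show "(exp ((ln (2 * pi) + ln k) / 2))\<^sup>2 = 2 * pi * k"
        using that by (simp add: exp_add)
    qed simp
    then have "normal_density 0 (sqrt k) x = exp (- (x\<^sup>2 / (2 * k))) / exp ((ln (2 * pi) + ln k) / 2)"
      using that unfolding normal_density_def by simp
    also have "\<dots> = exp (- (ln (2 * pi) + ln k) / 2 - x\<^sup>2 / (2 * k))"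
      by (simp only: exp_diff[symmetric]) (simp add: add_divide_distrib diff_divide_distrib)
    finally show ?thesis .
  qed
  have "normal_density 0 (sqrt \<kappa>) x * (normal_density 0 (sqrt \<kappa>) x / normal_density 0 (sqrt \<kappa>') x) powr t
      = C * normal_density 0 \<sigma> x" for x
  proof -
    have d: "x\<^sup>2 / (2 * (\<kappa> / D)) = x\<^sup>2 / (2 * \<kappa>) + t * (x\<^sup>2 / (2 * \<kappa>) - x\<^sup>2 / (2 * \<kappa>'))"
      using assms by (simp add: D_def field_simps)
    have l: "ln (\<kappa> / D) = ln \<kappa> - ln D" "ln (\<kappa> / \<kappa>') = ln \<kappa> - ln \<kappa>'" using D assms by (simp_all add: ln_div)
    have "0 < \<kappa> / D" using D assms by simp
    \<comment> \<open>The exponents are compared with the logarithms and quadratic terms as atoms: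
      \<open>L\<close> for ln (2 * pi), \<open>k\<close> and \<open>k'\<close> for ln \<kappa> and
      ln \<kappa>', \<open>e\<close> for ln D.\<close>
    have e: "- (L + k) / 2 - X + (- (L + k) / 2 - X - (- (L + k') / 2 - X')) * t
        = (- e - t * (k - k')) / 2 + (- (L + (k - e)) / 2 - (X + t * (X - X')))" for L k k' e X X' :: real
      by (simp add: field_simps)
    show ?thesis
      unfolding \<sigma>_def C_def n[OF assms(1)] n[OF assms(2)] n[OF \<open>0 < \<kappa> / D\<close>] d l
      by (simp only: exp_diff[symmetric] exp_powr_real exp_add[symmetric]) (rule arg_cong[where f = exp], rule e)
  qed
  then have "(\<integral>\<^sup>+x. normal_density 0 (sqrt \<kappa>) x *
      (normal_density 0 (sqrt \<kappa>) x / normal_density 0 (sqrt \<kappa>') x) powr t \<partial>lborel)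
      = (\<integral>\<^sup>+x. ennreal C * ennreal (normal_density 0 \<sigma> x) \<partial>lborel)"
    by (simp add: ennreal_mult C_def)
  also have "\<dots> = ennreal C"
    using \<sigma> by (simp add: nn_integral_cmult nn_integral_eq_integral)
  finally show ?thesis by (simp add: C_def D_def)
qed

text \<open>With \<open>c = 1 - \<kappa> / \<kappa>'\<close>, both \<open>c\<close> and \<open>c / (1 - c) = \<kappa>' / \<kappa> - 1\<close> have modulus at most \<open>d\<close>.\<close>

lemma renyi_exponent_le:
  fixes \<kappa> \<kappa>' d t :: real
  assumes "0 < \<kappa>" "0 < \<kappa>'" "\<bar>\<kappa>' - \<kappa>\<bar> \<le> d * \<kappa>" "\<bar>\<kappa>' - \<kappa>\<bar> \<le> d * \<kappa>'" "0 \<le> t" "t * d \<le> 1 / 2"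
  shows "0 < 1 + t * (1 - \<kappa> / \<kappa>')"
    and "- ln (1 + t * (1 - \<kappa> / \<kappa>')) - t * ln (\<kappa> / \<kappa>') \<le> t * d\<^sup>2 / 2 + t\<^sup>2 * d\<^sup>2"
proof -
  define c where "c = 1 - \<kappa> / \<kappa>'"
  have cabs: "\<bar>c\<bar> \<le> d"
  proof -
    have "c = (\<kappa>' - \<kappa>) / \<kappa>'" using assms(2) by (simp add: c_def diff_divide_distrib)
    then have "\<bar>c\<bar> = \<bar>\<kappa>' - \<kappa>\<bar> / \<kappa>'" using assms(2) by (simp add: abs_divide)
    then show ?thesis using assms(4) by (simp add: pos_divide_le_eq[OF assms(2)])
  qed
  then have d0: "0 \<le> d" by linarith
  have c2: "c\<^sup>2 \<le> d\<^sup>2" using cabs by (metis abs_ge_zero power2_abs power_mono)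
  have tc: "\<bar>t * c\<bar> \<le> 1 / 2"
    using mult_left_mono[OF cabs \<open>0 \<le> t\<close>] assms by (simp add: abs_mult)
  then show "0 < 1 + t * (1 - \<kappa> / \<kappa>')" unfolding c_def[symmetric] by linarith
  \<comment> \<open>The linear term - (t * c) cancels against t times the \<open>c\<close> in the
    bound \<open>b\<close> below, so the whole exponent is of second order in
    \<open>d\<close>.\<close>
  have a: "- ln (1 + t * c) \<le> - (t * c) + t\<^sup>2 * d\<^sup>2"
  proof -
    have "- ln (1 + t * c) \<le> - (t * c) + (t * c)\<^sup>2"
    proof (cases "0 \<le> t * c")
      case True
      then show ?thesis using ln_one_plus_ge_quadratic[OF True] by (smt (verit) zero_le_power2 field_sum_of_halves)
    next
      case False
      then show ?thesis using ln_one_minus_ge_quadratic[of "- (t * c)"] tc by simp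
    qed
    also have "(t * c)\<^sup>2 \<le> t\<^sup>2 * d\<^sup>2" using c2 by (simp add: power_mult_distrib mult_left_mono)
    finally show ?thesis by simp
  qed
  have b: "- ln (\<kappa> / \<kappa>') \<le> c + d\<^sup>2 / 2"
  proof (cases "\<kappa> \<le> \<kappa>'")
    case True
    define u where "u = \<kappa>' / \<kappa> - 1"
    have u: "0 \<le> u" "u \<le> d" "1 + u = \<kappa>' / \<kappa>" "u / (1 + u) = c"
      using assms True by (auto simp: u_def c_def field_simps)
    have "u\<^sup>2 \<le> d\<^sup>2" using u by (intro power_mono)
    moreover have "- ln (\<kappa> / \<kappa>') = ln (1 + u)" using assms by (simp add: u ln_div)
    ultimately show ?thesis using ln_one_plus_le_quadratic[OF u(1)] unfolding u(4) by linarith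
  next
    case False
    have "0 \<le> - c" using False assms by (simp add: c_def field_simps)
    moreover have "1 - c = \<kappa> / \<kappa>'" by (simp add: c_def)
    ultimately have "- c - c\<^sup>2 / 2 \<le> ln (\<kappa> / \<kappa>')" using ln_one_plus_ge_quadratic[of "- c"] by simp
    then show ?thesis using c2 by linarith
  qed
  show "- ln (1 + t * (1 - \<kappa> / \<kappa>')) - t * ln (\<kappa> / \<kappa>') \<le> t * d\<^sup>2 / 2 + t\<^sup>2 * d\<^sup>2"
    using a mult_left_mono[OF b \<open>0 \<le> t\<close>] unfolding c_def[symmetric] by (simp add: algebra_simps)
qed

text \<open>Here \<open>y = sqrt (2 * A)\<close> satisfies \<open>y ^ 3 - 3 * y\<^sup>2 + 4 = (y - 2)\<^sup>2 * (y + 1) \<ge> 0\<close>.\<close>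

lemma three_mult_le_sqrt_mult:
  fixes A :: real
  assumes "0 \<le> A"
  shows "3 * (A - ln 2) \<le> sqrt (2 * A) * (A + ln 2)"
proof -
  define y where "y = sqrt (2 * A)"
  have y: "0 \<le> y" "A = y\<^sup>2 / 2" using assms by (simp_all add: y_def)
  have "0 \<le> (y - 2)\<^sup>2 * (y + 1)" using y by simp
  moreover have "(y + 3) * (2 / 3) \<le> (y + 3) * ln 2"
    using y ln2_ge_two_thirds by (intro mult_left_mono) auto
  ultimately have "3 * (y\<^sup>2 / 2 - ln 2) \<le> y * (y\<^sup>2 / 2 + ln 2)"
    using y(1) by (simp add: power2_eq_square algebra_simps)
  then show ?thesis by (simp add: y_def[symmetric] y(2)[symmetric])
qed

text \<open>With D = ln (1 / \<delta>), the tilt gives - t * \<epsilon> = - 3 * D. The two Renyi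
  terms, taken at relative deviation 2 / w, cost at most 3 * D / 2 and D / 2, which leaves - D = ln
  \<delta>.\<close>

lemma privacy_exponent:
  fixes \<epsilon> \<delta> w :: real and r :: nat
  defines "t \<equiv> 3 * ln (1 / \<delta>) / \<epsilon>"
  assumes "\<epsilon> > 0" "\<delta> > 0" "\<delta> < 1" "r \<ge> 1"
    and w: "w = sqrt (32 * real r * ln (2 / \<delta>)) / \<epsilon> * ln (4 * real r / \<delta>)"
    and \<epsilon>: "\<epsilon> \<le> 16 * ln (2 / \<delta>) * (ln (4 * real r / \<delta>))\<^sup>2"
  shows "0 < w" "0 \<le> t" "t * (2 / w) \<le> 1 / 2"
    "- t * \<epsilon> + real r * ((t * (2 / w)\<^sup>2 / 2 + t\<^sup>2 * (2 / w)\<^sup>2) / 2) \<le> ln \<delta>"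
proof -
  define A B D where "A = ln (2 / \<delta>)" and "B = ln (4 * real r / \<delta>)" and "D = ln (1 / \<delta>)"
  have D: "0 < D" "A = D + ln 2" "ln \<delta> = - D"
    using assms by (simp_all add: D_def A_def ln_div)
  have A: "0 < A" "D \<le> A" using D ln2_ge_two_thirds by simp_all
  \<comment> \<open>Here B = ln r + A + ln 2, and 2 * ln 2 \<ge> 4 / 3.\<close>
  have B: "A + ln 2 \<le> B" "4 / 3 \<le> B"
  proof -
    have "B = ln (real r) + 2 * ln 2 + D"
      using assms ln_mult[of 4 "real r"] ln_realpow[of 2 2] by (simp add: B_def D_def ln_div ln_mult)
    moreover have "0 \<le> ln (real r)" using assms by simp
    ultimately show "A + ln 2 \<le> B" "4 / 3 \<le> B" using D ln2_ge_two_thirds by auto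
  qed
  have sq: "0 < sqrt (32 * real r * A)" using A assms by simp
  show w0: "0 < w" using sq B assms(2) unfolding w A_def[symmetric] B_def[symmetric] by simp
  have we: "w * \<epsilon> = sqrt (32 * real r * A) * B"
    using assms(2) unfolding w A_def[symmetric] B_def[symmetric] by simp
  show t: "0 \<le> t" using D assms(2) by (simp add: t_def D_def)
  have te: "t * \<epsilon> = 3 * D" using assms(2) by (simp add: t_def D_def)
  \<comment> \<open>Since t * \<epsilon> = 3 * D, this says 4 * t \<le> w, the smallness condition t
    * (2 / w) \<le> 1 / 2.\<close>
  have "12 * D \<le> w * \<epsilon>"
  proof -
    have "12 * D = 4 * (3 * (A - ln 2))" using D by simp
    also have "\<dots> \<le> 4 * (sqrt (2 * A) * (A + ln 2))"
      using three_mult_le_sqrt_mult[of A] A by simp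
    also have "\<dots> \<le> 4 * (sqrt (2 * A) * B)" using A B by (intro mult_left_mono) auto
    also have "\<dots> = sqrt (32 * A) * B" using real_sqrt_mult[of 16 "2 * A"] by simp
    also have "\<dots> \<le> sqrt (32 * real r * A) * B" using A B assms by (intro mult_right_mono real_sqrt_le_mono) auto
    finally show ?thesis using we by simp
  qed
  then have "4 * t * \<epsilon> \<le> w * \<epsilon>" using te by simp
  then have "4 * t \<le> w" using assms(2) by simp
  then show "t * (2 / w) \<le> 1 / 2" using w0 by (simp add: field_simps)
  have w2: "w\<^sup>2 * \<epsilon>\<^sup>2 = 32 * real r * A * B\<^sup>2"
    using arg_cong[OF we, of "\<lambda>x. x\<^sup>2"] A by (simp add: power_mult_distrib)
  have AB: "0 < A * B\<^sup>2" using A B by simp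
  have r: "real r * (2 / w)\<^sup>2 = \<epsilon>\<^sup>2 / (8 * (A * B\<^sup>2))"
    using w2 A B w0 assms(2) by (simp add: power_divide field_simps)
  \<comment> \<open>The upper bound on \<epsilon> enters here, to control the Renyi term that is
    linear in \<open>t\<close>.\<close>
  have "\<epsilon>\<^sup>2 / (8 * (A * B\<^sup>2)) \<le> 2 * \<epsilon>"
    using \<epsilon> assms(2) AB unfolding A_def[symmetric] B_def[symmetric]
    by (simp add: field_simps power2_eq_square)
  then have "t * (\<epsilon>\<^sup>2 / (8 * (A * B\<^sup>2))) / 4 \<le> 3 * D / 2"
    using mult_left_mono[OF _ t] te by fastforce
  moreover have "t\<^sup>2 * (\<epsilon>\<^sup>2 / (8 * (A * B\<^sup>2))) / 2 \<le> D / 2"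
  proof -
    have "t\<^sup>2 * \<epsilon>\<^sup>2 = 9 * D\<^sup>2" using arg_cong[OF te, of "\<lambda>x. x\<^sup>2"] by (simp add: power_mult_distrib)
    \<comment> \<open>From D \<le> A and B^2 \<ge> 16 / 9 \<ge> 9 / 8.\<close>
    moreover have "9 * D\<^sup>2 \<le> 8 * (A * B\<^sup>2) * D"
    proof -
      have "(4 / 3)\<^sup>2 \<le> B\<^sup>2" using B by (intro power_mono) auto
      then have "9 / 8 \<le> B\<^sup>2" by (simp add: power2_eq_square)
      then have "D * (9 / 8) \<le> A * B\<^sup>2" using A D by (intro mult_mono) auto
      then have "8 * D * (D * (9 / 8)) \<le> 8 * D * (A * B\<^sup>2)" using D by (intro mult_left_mono) auto
      then show ?thesis by (simp add: power2_eq_square mult_ac)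
    qed
    ultimately show ?thesis using AB by (simp add: divide_le_eq mult_ac)
  qed
  moreover have "real r * ((t * (2 / w)\<^sup>2 / 2 + t\<^sup>2 * (2 / w)\<^sup>2) / 2)
      = t * (real r * (2 / w)\<^sup>2) / 4 + t\<^sup>2 * (real r * (2 / w)\<^sup>2) / 2"
    by (simp add: algebra_simps)
  ultimately show "- t * \<epsilon> + real r * ((t * (2 / w)\<^sup>2 / 2 + t\<^sup>2 * (2 / w)\<^sup>2) / 2) \<le> ln \<delta>"
    using te D(3) unfolding r by simp
qed

section \<open>Laws of Gram matrices\<close>

text \<open>\<open>B (i, p)\<close> is the vector multiplying the Gaussian entry \<open>M (i, p)\<close> in row \<open>i\<close>. The rows share these
  vectors in the algorithm; letting them differ allows rotating one row at a time.\<close>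

definition gram :: "nat \<Rightarrow> 'p set \<Rightarrow> (nat \<times> 'p \<Rightarrow> real^'n) \<Rightarrow> (nat \<times> 'p \<Rightarrow> real) \<Rightarrow> 'n square_matrix" where
  "gram r P B M = (\<chi> x y. 1 / real r *
     (\<Sum>i<r. (\<Sum>p\<in>P. M (i, p) *\<^sub>R B (i, p)) $ x * (\<Sum>p\<in>P. M (i, p) *\<^sub>R B (i, p)) $ y))"

definition gram_law :: "nat \<Rightarrow> 'p set \<Rightarrow> (nat \<times> 'p \<Rightarrow> real^'n) \<Rightarrow> 'n square_matrix measure" where
  "gram_law r P B = distr (gaussian_array ({..<r} \<times> P)) borel (gram r P B)"

lemma gram_measurable [measurable]: "gram r P B \<in> borel_measurable (gaussian_array ({..<r} \<times> P))"
proof -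
  have comp: "(\<lambda>M. M k) \<in> borel_measurable (gaussian_array ({..<r} \<times> P))" if "k \<in> {..<r} \<times> P" for k
    using measurable_component_singleton[OF that, of "\<lambda>_. std_normal_distribution"] by simp
  have "(\<lambda>M. gram r P B M $ x $ y) \<in> borel_measurable (gaussian_array ({..<r} \<times> P))" for x y
    unfolding gram_def sum_component vector_scaleR_component vec_lambda_beta
    by (intro borel_measurable_times borel_measurable_sum borel_measurable_const comp) auto
  then show ?thesis
    by (intro borel_measurable_euclidean_space[THEN iffD2])
       (auto simp: Basis_vec_def inner_axis)
qed

lemma gram_cong:
  assumes "\<And>i. i < r \<Longrightarrow> (\<Sum>p\<in>P. M (i, p) *\<^sub>R B (i, p)) = (\<Sum>p\<in>P. M' (i, p) *\<^sub>R B' (i, p))"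
  shows "gram r P B M = gram r P B' M'"
  unfolding gram_def using assms by simp

lemma gram_law_cong:
  assumes "\<And>k. k \<in> {..<r} \<times> P \<Longrightarrow> B k = B' k"
  shows "gram_law r P B = gram_law r P B'"
proof -
  have "gram r P B = gram r P B'"
    by (intro ext gram_cong sum.cong) (auto simp: assms)
  then show ?thesis by (simp add: gram_law_def)
qed

text \<open>By adjointness, rotating two of the vectors in row \<open>i\<close> amounts to rotating
  the two Gaussian entries that multiply them, and the law of the array is invariant under
  that.\<close>

lemma gram_law_givens_cell:
  assumes "finite P" "i < r" "p \<in> P" "q \<in> P" "p \<noteq> q" "c\<^sup>2 + s\<^sup>2 = 1" "c \<noteq> 0"
  shows "gram_law r P (B((i, p) := c *\<^sub>R B (i, p) + s *\<^sub>R B (i, q), (i, q) := - s *\<^sub>R B (i, p) + c *\<^sub>R B (i, q)))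
    = gram_law r P B" (is "gram_law r P ?B = _")
proof -
  let ?G = "gaussian_array ({..<r} \<times> P)" and ?g = "givens (i, p) (i, q) c s"
  define R where "R = P - {p, q}"
  have P: "P = insert p (insert q R)" "finite R" "p \<notin> R" "q \<notin> R" using assms by (auto simp: R_def)
  have "gram r P ?B M = gram r P B (?g M)" for M
  proof (rule gram_cong)
    fix j
    show "(\<Sum>x\<in>P. M (j, x) *\<^sub>R ?B (j, x)) = (\<Sum>x\<in>P. ?g M (j, x) *\<^sub>R B (j, x))"
    proof (cases "j = i")
      case True
      have "(\<Sum>x\<in>R. M (i, x) *\<^sub>R ?B (i, x)) = (\<Sum>x\<in>R. ?g M (i, x) *\<^sub>R B (i, x))"
        using P by (intro sum.cong) (auto simp: givens_def)
      then show ?thesis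
        using True assms(5) P by (simp add: givens_def scaleR_add_right scaleR_add_left scaleR_diff_left scaleR_diff_right mult_ac)
    next
      case False
      then show ?thesis by (intro sum.cong) (auto simp: givens_def)
    qed
  qed
  then have "gram r P ?B = gram r P B \<circ> ?g" by (simp add: fun_eq_iff)
  then have "gram_law r P ?B = distr ?G borel (gram r P B \<circ> ?g)" by (simp only: gram_law_def)
  also have "\<dots> = distr (distr ?G ?G ?g) borel (gram r P B)"
    using assms by (subst distr_distr) (auto intro!: measurable_givens)
  also have "distr ?G ?G ?g = ?G" using assms by (intro distr_givens) auto
  finally show ?thesis by (simp only: gram_law_def)
qed

text \<open>A hybrid argument: \<open>B m\<close> has the first \<open>m\<close> rows rotated, and
  passing from \<open>m\<close> to \<open>Suc m\<close> rotates a single row.\<close>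

lemma gram_law_givens:
  fixes v :: "'p \<Rightarrow> real^'n"
  assumes "finite P" "p \<in> P" "q \<in> P" "p \<noteq> q" "c\<^sup>2 + s\<^sup>2 = 1" "c \<noteq> 0"
  shows "gram_law r P (v(p := c *\<^sub>R v p + s *\<^sub>R v q, q := - s *\<^sub>R v p + c *\<^sub>R v q) \<circ> snd)
    = gram_law r P (v \<circ> snd)" (is "gram_law r P (?v \<circ> snd) = _")
proof -
  define B where "B m = (\<lambda>(i, x). if i < m then ?v x else v x)" for m :: nat
  have "gram_law r P (B m) = gram_law r P (v \<circ> snd)" if "m \<le> r" for m
    using that
  proof (induction m)
    case 0
    then show ?case by (intro gram_law_cong) (auto simp: B_def)
  next
    case (Suc m)
    have "gram_law r P (B (Suc m)) = gram_law r P ((B m)((m, p) := c *\<^sub>R B m (m, p) + s *\<^sub>R B m (m, q),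
        (m, q) := - s *\<^sub>R B m (m, p) + c *\<^sub>R B m (m, q)))"
      using assms(4) by (intro gram_law_cong) (auto simp: B_def less_Suc_eq split: if_splits)
    also have "\<dots> = gram_law r P (B m)"
      using assms Suc.prems by (intro gram_law_givens_cell) auto
    finally show ?case using Suc by simp
  qed
  from this[of r] show ?thesis
    by (subst gram_law_cong[of r P "?v \<circ> snd" "B r"]) (auto simp: B_def)
qed

text \<open>Series law, then parallel law: the path through \<open>x\<close> is rotated into a conductance \<open>k x\<close> in the
  direction \<open>b\<close>, which is then absorbed by the entry \<open>p0\<close>. The remaining vectors \<open>u\<close> do not depend on \<open>h\<close>.\<close>

lemma gram_law_series_parallel:
  fixes v :: "'p \<Rightarrow> real^'n"
  assumes "finite X" "finite P" "p0 \<in> P"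
    and "f ` X \<subseteq> P" "g ` X \<subseteq> P" "inj_on f X" "inj_on g X" "f ` X \<inter> g ` X = {}" "p0 \<notin> f ` X" "p0 \<notin> g ` X"
    and "\<And>x. x \<in> X \<Longrightarrow> 0 < k x"
    and "\<And>x. x \<in> X \<Longrightarrow> \<exists>c s. c\<^sup>2 + s\<^sup>2 = 1 \<and> c \<noteq> 0 \<and> c *\<^sub>R v (f x) + s *\<^sub>R v (g x) = sqrt (k x) *\<^sub>R b"
  shows "\<exists>u. \<forall>h>0. gram_law r P (v(p0 := sqrt h *\<^sub>R b) \<circ> snd)
    = gram_law r P (u(p0 := sqrt (h + sum k X) *\<^sub>R b) \<circ> snd)"
  using assms
proof (induction X arbitrary: v rule: finite_induct)
  case empty
  then show ?case by (intro exI[of _ v]) simp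
next
  case (insert x X)
  obtain c s where cs: "c\<^sup>2 + s\<^sup>2 = 1" "c \<noteq> 0" "c *\<^sub>R v (f x) + s *\<^sub>R v (g x) = sqrt (k x) *\<^sub>R b"
    using insert.prems(11)[of x] by blast
  define z where "z = - s *\<^sub>R v (f x) + c *\<^sub>R v (g x)"
  \<comment> \<open>After both rotations the vector at \<open>f x\<close> is spent, its conductance
    having moved to \<open>p0\<close>, and \<open>z\<close> is what remains of the path. Neither
    involves \<open>h\<close>, so one \<open>u\<close> serves all \<open>h\<close>.\<close>
  define v' where "v' = v(f x := 0, g x := z)"
  have ne: "f x \<noteq> g x" "p0 \<noteq> f x" "p0 \<noteq> g x" "f x \<in> P" "g x \<in> P" and k: "0 < k x"
    using insert.prems(3,4,7-10) by auto
  have step: "gram_law r P (v(p0 := sqrt h *\<^sub>R b) \<circ> snd) = gram_law r P (v'(p0 := sqrt (h + k x) *\<^sub>R b) \<circ> snd)"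
    if h: "0 < h" for h
  proof -
    let ?v = "v(p0 := sqrt h *\<^sub>R b)"
    let ?v1 = "v(p0 := sqrt h *\<^sub>R b, f x := sqrt (k x) *\<^sub>R b, g x := z)"
    \<comment> \<open>This angle aligns (sqrt h, sqrt (k x)) with the first axis: the component
      along it has length sqrt (h + k x), the one across it vanishes. Since h > 0, the cosine is
      nonzero.\<close>
    let ?c = "sqrt (h / (h + k x))" and ?s = "sqrt (k x / (h + k x))"
    have pos: "0 < h + k x" using h k by simp
    have norm: "?c\<^sup>2 + ?s\<^sup>2 = 1" "?c \<noteq> 0"
      using h k pos by (simp_all add: add_divide_distrib[symmetric])
    have along: "?c * sqrt h + ?s * sqrt (k x) = sqrt (h + k x)"
    proof -
      have "?c * sqrt h + ?s * sqrt (k x) = (sqrt h * sqrt h + sqrt (k x) * sqrt (k x)) / sqrt (h + k x)"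
        by (simp only: real_sqrt_divide add_divide_distrib times_divide_eq_left)
      then show ?thesis using h k pos by (simp add: real_div_sqrt)
    qed
    have across: "- ?s * sqrt h + ?c * sqrt (k x) = 0"
      by (simp add: real_sqrt_divide)
    have "gram_law r P (?v \<circ> snd)
        = gram_law r P (?v(f x := c *\<^sub>R ?v (f x) + s *\<^sub>R ?v (g x), g x := - s *\<^sub>R ?v (f x) + c *\<^sub>R ?v (g x)) \<circ> snd)"
      by (rule gram_law_givens[symmetric, OF insert.prems(1) ne(4,5,1) cs(1,2)])
    also have "?v(f x := c *\<^sub>R ?v (f x) + s *\<^sub>R ?v (g x), g x := - s *\<^sub>R ?v (f x) + c *\<^sub>R ?v (g x)) = ?v1"
      using ne(2,3)[symmetric] by (simp only: fun_upd_other cs(3) z_def if_False fun_upd_apply)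
    also have "gram_law r P (?v1 \<circ> snd)
        = gram_law r P (?v1(p0 := ?c *\<^sub>R ?v1 p0 + ?s *\<^sub>R ?v1 (f x), f x := - ?s *\<^sub>R ?v1 p0 + ?c *\<^sub>R ?v1 (f x)) \<circ> snd)"
      by (rule gram_law_givens[symmetric, OF insert.prems(1,2) ne(4,2) norm])
    also have "?v1(p0 := ?c *\<^sub>R ?v1 p0 + ?s *\<^sub>R ?v1 (f x), f x := - ?s *\<^sub>R ?v1 p0 + ?c *\<^sub>R ?v1 (f x))
        = v'(p0 := sqrt (h + k x) *\<^sub>R b)"
    proof -
      have v1: "?v1 p0 = sqrt h *\<^sub>R b" "?v1 (f x) = sqrt (k x) *\<^sub>R b" using ne(1-3) by simp_all
      have "?c *\<^sub>R ?v1 p0 + ?s *\<^sub>R ?v1 (f x) = sqrt (h + k x) *\<^sub>R b"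
        "- ?s *\<^sub>R ?v1 p0 + ?c *\<^sub>R ?v1 (f x) = 0"
        unfolding v1 scaleR_scaleR scaleR_add_left[symmetric] along across by simp_all
      then show ?thesis using ne(1-3) by (simp only:) (auto simp: v'_def fun_eq_iff)
    qed
    finally show ?thesis .
  qed
  have "\<exists>u. \<forall>h>0. gram_law r P (v'(p0 := sqrt h *\<^sub>R b) \<circ> snd) = gram_law r P (u(p0 := sqrt (h + sum k X) *\<^sub>R b) \<circ> snd)"
  proof (rule insert.IH)
    fix y assume y: "y \<in> X"
    \<comment> \<open>Injectivity and disjointness ensure that the rotations for \<open>x\<close>
      leave the two vectors of every other path untouched.\<close>
    have "f x \<notin> f ` X" "g x \<notin> g ` X" "g x \<notin> f ` X" "f x \<notin> g ` X"
      using insert.prems(5-7) insert.hyps(2) by (auto simp: inj_on_insert)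
    with y have "f y \<noteq> f x" "g y \<noteq> g x" "f y \<noteq> g x" "g y \<noteq> f x" by (metis imageI)+
    then have "v' (f y) = v (f y)" "v' (g y) = v (g y)" by (simp_all add: v'_def)
    then show "\<exists>c s. c\<^sup>2 + s\<^sup>2 = 1 \<and> c \<noteq> 0 \<and> c *\<^sub>R v' (f y) + s *\<^sub>R v' (g y) = sqrt (k y) *\<^sub>R b"
      using insert.prems(11)[of y] y by simp
  qed (use insert.prems in \<open>auto simp: inj_on_insert\<close>)
  then obtain u where u: "\<forall>h>0. gram_law r P (v'(p0 := sqrt h *\<^sub>R b) \<circ> snd)
      = gram_law r P (u(p0 := sqrt (h + sum k X) *\<^sub>R b) \<circ> snd)" by blast
  have "gram_law r P (v(p0 := sqrt h *\<^sub>R b) \<circ> snd)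
      = gram_law r P (u(p0 := sqrt (h + sum k (insert x X)) *\<^sub>R b) \<circ> snd)" if "0 < h" for h
  proof -
    have "h + sum k (insert x X) = h + k x + sum k X" using insert.hyps by simp
    then show ?thesis using step[OF that] u k that by (simp only: add_pos_pos)
  qed
  then show ?case by blast
qed

section \<open>Comparison of Gram laws that differ in one conductance\<close>

text \<open>The scaled law is expressed relative to the standard normal law instead of Lebesgue
  measure, so that it can serve as a factor in \<open>distr_PiM_eq_density\<close>.\<close>

lemma distr_std_normal_scale:
  assumes "0 < \<sigma>"
  shows "distr std_normal_distribution std_normal_distribution (\<lambda>x. \<sigma> * x)
    = density std_normal_distribution (\<lambda>x. ennreal (normal_density 0 \<sigma> x / std_normal_density x))"
proof -
  interpret N: prob_space std_normal_distribution by (rule prob_space_normal_density) simp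
  have "distributed std_normal_distribution lborel (\<lambda>x. x) std_normal_density"
    by (simp add: distributed_def distr_id2)
  from N.normal_density_affine[OF this, of \<sigma> 0] assms
  have "distr std_normal_distribution lborel (\<lambda>x. \<sigma> * x) = density lborel (normal_density 0 \<sigma>)"
    by (simp add: distributed_def)
  moreover have "distr std_normal_distribution std_normal_distribution (\<lambda>x. \<sigma> * x)
      = distr std_normal_distribution lborel (\<lambda>x. \<sigma> * x)"
    by (rule distr_cong) auto
  moreover have "density std_normal_distribution (\<lambda>x. ennreal (normal_density 0 \<sigma> x / std_normal_density x))
      = density lborel (normal_density 0 \<sigma>)"
  proof -
    have "std_normal_density x * (normal_density 0 \<sigma> x / std_normal_density x) = normal_density 0 \<sigma> x" for x
      using normal_density_pos[of 1 0 x] by simp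
    then show ?thesis by (subst density_density_eq) (auto simp: ennreal_mult'[symmetric])
  qed
  ultimately show ?thesis by simp
qed

text \<open>Scaling the vector at \<open>p0\<close> amounts to scaling the Gaussian entries in
  column \<open>p0\<close>. Both laws are therefore images, under the same map
  \<open>?\<Gamma>\<close>, of product densities, which are compared on the preimage of
  \<open>S\<close>.\<close>

lemma gram_law_le:
  fixes u :: "'p \<Rightarrow> real^'n"
  assumes P: "finite P" "p0 \<in> P" and \<kappa>: "0 < \<kappa>" "0 < \<kappa>'" and t: "0 \<le> t" "0 < 1 + t * (1 - \<kappa> / \<kappa>')"
    and S: "S \<in> sets borel"
  shows "emeasure (gram_law r P (u(p0 := sqrt \<kappa> *\<^sub>R b) \<circ> snd)) S
    \<le> exp \<epsilon> * emeasure (gram_law r P (u(p0 := sqrt \<kappa>' *\<^sub>R b) \<circ> snd)) S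
      + exp (- t * \<epsilon> + real r * ((- ln (1 + t * (1 - \<kappa> / \<kappa>')) - t * ln (\<kappa> / \<kappa>')) / 2))"
proof -
  let ?K = "{..<r} \<times> P" and ?N = "std_normal_distribution"
  let ?G = "gaussian_array ?K" and ?\<Gamma> = "gram r P (u(p0 := b) \<circ> snd)"
  define \<sigma> where "\<sigma> h k = (if snd k = p0 then h else 1)" for h :: real and k :: "nat \<times> 'p"
  define \<rho> where "\<rho> h k x = normal_density 0 (sqrt (\<sigma> h k)) x / std_normal_density x" for h k x
  define E where "E = exp ((- ln (1 + t * (1 - \<kappa> / \<kappa>')) - t * ln (\<kappa> / \<kappa>')) / 2)"
  have \<sigma>: "0 < \<sigma> h k" if "0 < h" for h k using that by (simp add: \<sigma>_def)
  have \<rho>_pos: "0 < \<rho> h k x" if "0 < h" for h k x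
    using \<sigma>[OF that] by (simp add: \<rho>_def normal_density_pos)
  have \<rho>_meas: "\<rho> h k \<in> borel_measurable ?N" for h k
    unfolding \<rho>_def by measurable
  have prob: "prob_space ?N" by (rule prob_space_normal_density) simp
  have law: "gram_law r P (u(p0 := sqrt h *\<^sub>R b) \<circ> snd)
      = distr (density ?G (\<lambda>x. \<Prod>k\<in>?K. ennreal (\<rho> h k (x k)))) borel ?\<Gamma>" if h: "0 < h" for h
  proof -
    let ?f = "\<lambda>x. \<lambda>k\<in>?K. sqrt (\<sigma> h k) * x k"
    have f: "?f \<in> ?G \<rightarrow>\<^sub>M ?G"
      by (intro measurable_restrict)
        (auto intro!: borel_measurable_times measurable_component_singleton[where M = "\<lambda>_. ?N", simplified])
    have "distr ?G ?G ?f = density ?G (\<lambda>x. \<Prod>k\<in>?K. ennreal (\<rho> h k (x k)))"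
      using P \<sigma>[OF h]
      by (intro distr_PiM_eq_density[of ?K "\<lambda>_. ?N" "\<lambda>k x. sqrt (\<sigma> h k) * x" "\<lambda>k x. ennreal (\<rho> h k x)"] prob)
        (auto simp: \<rho>_def intro!: distr_std_normal_scale)
    then have "distr (density ?G (\<lambda>x. \<Prod>k\<in>?K. ennreal (\<rho> h k (x k)))) borel ?\<Gamma> = distr ?G borel (?\<Gamma> \<circ> ?f)"
      using distr_distr[OF gram_measurable f] by simp
    also have "?\<Gamma> \<circ> ?f = gram r P (u(p0 := sqrt h *\<^sub>R b) \<circ> snd)"
      unfolding comp_def by (intro ext gram_cong sum.cong) (auto simp: \<sigma>_def)
    finally show ?thesis by (simp only: gram_law_def)
  qed
  \<comment> \<open>Off column \<open>p0\<close> both variances are 1 and the Renyi moment is 1; in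
    that column it is \<open>E\<close>.\<close>
  have int: "(\<integral>\<^sup>+x. \<rho> \<kappa> k x * (\<rho> \<kappa> k x / \<rho> \<kappa>' k x) powr t \<partial>?N) = ennreal (if snd k = p0 then E else 1)" for k
  proof -
    have "(\<integral>\<^sup>+x. \<rho> \<kappa> k x * (\<rho> \<kappa> k x / \<rho> \<kappa>' k x) powr t \<partial>?N)
       = (\<integral>\<^sup>+x. normal_density 0 (sqrt (\<sigma> \<kappa> k)) x *
        (normal_density 0 (sqrt (\<sigma> \<kappa> k)) x / normal_density 0 (sqrt (\<sigma> \<kappa>' k)) x) powr t \<partial>lborel)"
    proof (subst nn_integral_density)
      have *: "std_normal_density x * (\<rho> \<kappa> k x * (\<rho> \<kappa> k x / \<rho> \<kappa>' k x) powr t)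
        = normal_density 0 (sqrt (\<sigma> \<kappa> k)) x *
        (normal_density 0 (sqrt (\<sigma> \<kappa> k)) x / normal_density 0 (sqrt (\<sigma> \<kappa>' k)) x) powr t" for x
        using normal_density_pos[of 1 0 x] unfolding \<rho>_def by simp
      show "(\<integral>\<^sup>+x. ennreal (std_normal_density x) * ennreal (\<rho> \<kappa> k x * (\<rho> \<kappa> k x / \<rho> \<kappa>' k x) powr t) \<partial>lborel)
        = (\<integral>\<^sup>+x. normal_density 0 (sqrt (\<sigma> \<kappa> k)) x *
        (normal_density 0 (sqrt (\<sigma> \<kappa> k)) x / normal_density 0 (sqrt (\<sigma> \<kappa>' k)) x) powr t \<partial>lborel)"
        by (simp only: ennreal_mult'[symmetric] normal_density_nonneg *)
    qed (use \<rho>_meas in auto)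
    also have "\<dots> = ennreal (if snd k = p0 then E else 1)"
      using \<kappa> t by (subst nn_integral_normal_renyi) (auto simp: \<sigma>_def E_def)
    finally show ?thesis .
  qed
  let ?A = "?\<Gamma> -` S \<inter> space ?G"
  have A: "?A \<in> sets ?G" using S by measurable
  have em: "emeasure (gram_law r P (u(p0 := sqrt h *\<^sub>R b) \<circ> snd)) S
      = emeasure (density ?G (\<lambda>x. \<Prod>k\<in>?K. ennreal (\<rho> h k (x k)))) ?A" if "0 < h" for h
    unfolding law[OF that] using S by (subst emeasure_distr) auto
  have "emeasure (gram_law r P (u(p0 := sqrt \<kappa> *\<^sub>R b) \<circ> snd)) S
    \<le> exp \<epsilon> * emeasure (gram_law r P (u(p0 := sqrt \<kappa>' *\<^sub>R b) \<circ> snd)) S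
      + exp (- t * \<epsilon>) * (\<Prod>k\<in>?K. \<integral>\<^sup>+x. \<rho> \<kappa> k x * (\<rho> \<kappa> k x / \<rho> \<kappa>' k x) powr t \<partial>?N)"
    unfolding em[OF \<kappa>(1)] em[OF \<kappa>(2)]
    using P \<kappa> by (intro emeasure_prod_density_le prob t(1) A \<rho>_meas \<rho>_pos) auto
  also have "(\<Prod>k\<in>?K. \<integral>\<^sup>+x. \<rho> \<kappa> k x * (\<rho> \<kappa> k x / \<rho> \<kappa>' k x) powr t \<partial>?N) = ennreal (E ^ r)"
  proof -
    \<comment> \<open>Each of the \<open>r\<close> rows has exactly one entry in column
      \<open>p0\<close>.\<close>
    have "(\<Prod>k\<in>?K. if snd k = p0 then E else 1) = (\<Prod>i<r. \<Prod>p\<in>P. if p = p0 then E else 1)"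
      unfolding prod.cartesian_product by (intro prod.cong) auto
    also have "\<dots> = E ^ r" using P by simp
    finally show ?thesis unfolding int by (subst prod_ennreal) (auto simp: E_def)
  qed
  also have "ennreal (exp (- t * \<epsilon>)) * ennreal (E ^ r)
      = ennreal (exp (- t * \<epsilon> + real r * ((- ln (1 + t * (1 - \<kappa> / \<kappa>')) - t * ln (\<kappa> / \<kappa>')) / 2)))"
    unfolding E_def by (simp only: ennreal_mult'[symmetric] exp_ge_zero exp_add exp_of_nat_mult)
  finally show ?thesis .
qed

section \<open>The algorithm\<close>

definition edge_vector :: "'n weighting \<Rightarrow> 'n \<times> 'n \<Rightarrow> real^'n" where
  "edge_vector H p = (\<chi> x. edge_matrix H p x)"

text \<open>Interchanging finite sums regroups the matrix product as the sum, over the rows of M E,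
  of their outer squares.\<close>

lemma jl_laplacian_eq_gram_law:
  "jl_laplacian r w W = gram_law r vertex_pairs (edge_vector (reweight w W) \<circ> snd)"
proof -
  have "sketched_laplacian r H (curry M) = gram r vertex_pairs (edge_vector H \<circ> snd) M"
    for H :: "'a weighting" and M
  proof -
    have "(\<Sum>p\<in>vertex_pairs. E p * (\<Sum>i<r. M (i, p) * Z i)) = (\<Sum>i<r. (\<Sum>p\<in>vertex_pairs. M (i, p) * E p) * Z i)"
      for E :: "'a \<times> 'a \<Rightarrow> real" and Z
    proof -
      have "(\<Sum>p\<in>vertex_pairs. E p * (\<Sum>i<r. M (i, p) * Z i)) = (\<Sum>p\<in>vertex_pairs. \<Sum>i<r. M (i, p) * E p * Z i)"
        by (simp add: sum_distrib_left mult_ac)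
      also have "\<dots> = (\<Sum>i<r. \<Sum>p\<in>vertex_pairs. M (i, p) * E p * Z i)"
        by (rule sum.swap)
      finally show ?thesis by (simp add: sum_distrib_right)
    qed
    then show ?thesis
      by (simp add: sketched_laplacian_def gram_def mat_prod_def mat_transpose_def curry_def edge_vector_def)
  qed
  then show ?thesis
    unfolding jl_laplacian_def gram_law_def gaussian_matrix_def by simp
qed

section \<open>The effective conductance between the endpoints of the changed pair\<close>

text \<open>The representative in \<open>vertex_pairs\<close> of an unordered pair; the edges of a
  path from a through x to b may be ordered either way.\<close>

definition vertex_pair :: "'n::linorder \<Rightarrow> 'n \<Rightarrow> 'n \<times> 'n" where
  "vertex_pair u v = (min u v, max u v)"

lemma vertex_pair_mem: "u \<noteq> v \<Longrightarrow> vertex_pair u v \<in> vertex_pairs"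
  by (auto simp: vertex_pair_def vertex_pairs_def min_def max_def)

lemma vertex_pair_eq_iff: "vertex_pair u v = vertex_pair u' v' \<longleftrightarrow> {u, v} = {u', v'}"
  by (auto simp: vertex_pair_def min_def max_def doubleton_eq_iff split: if_splits)

text \<open>The edge matrix orients each pair from its smaller to its larger vertex; the sign
  \<sigma> permits the orientation along a path instead.\<close>

lemma edge_vector_vertex_pair:
  assumes "\<And>u v. H u v = H v u" "u \<noteq> v"
  shows "\<exists>\<sigma>::real. \<sigma>\<^sup>2 = 1 \<and> edge_vector H (vertex_pair u v) = (\<sigma> * sqrt (H u v)) *\<^sub>R (axis u 1 - axis v 1)"
proof (cases "u < v")
  case True
  then show ?thesis
    by (intro exI[of _ 1]) (auto simp: edge_vector_def edge_matrix_def vertex_pair_def vec_eq_iff axis_def)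
next
  case False
  then have "v < u" using assms by simp
  then show ?thesis
    using assms(1)[of u v]
    by (intro exI[of _ "-1"]) (auto simp: edge_vector_def edge_matrix_def vertex_pair_def vec_eq_iff axis_def)
qed

text \<open>The angle is chosen so that both vectors receive the same coefficient, the square root
  of the conductance of h1 and h2 in series; the signs in the cosine and sine undo the
  orientations.\<close>

lemma series_rotation:
  fixes A B :: "real^'n" and h1 h2 \<sigma> \<tau> :: real
  assumes "0 < h1" "0 < h2" "\<sigma>\<^sup>2 = 1" "\<tau>\<^sup>2 = 1"
  shows "\<exists>c s. c\<^sup>2 + s\<^sup>2 = 1 \<and> c \<noteq> 0 \<and>
    c *\<^sub>R ((\<sigma> * sqrt h1) *\<^sub>R A) + s *\<^sub>R ((\<tau> * sqrt h2) *\<^sub>R B) = sqrt (h1 * h2 / (h1 + h2)) *\<^sub>R (A + B)"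
proof (intro exI conjI)
  let ?c = "\<sigma> * sqrt (h2 / (h1 + h2))" and ?s = "\<tau> * sqrt (h1 / (h1 + h2))"
  show "?c\<^sup>2 + ?s\<^sup>2 = 1"
    using assms by (simp add: power_mult_distrib add_divide_distrib[symmetric] add.commute)
  show "?c \<noteq> 0" using assms by auto
  have "\<sigma> * \<sigma> = 1" "\<tau> * \<tau> = 1" using assms(3,4) by (simp_all add: power2_eq_square)
  then have "?c * (\<sigma> * sqrt h1) = sqrt (h1 * h2 / (h1 + h2))" "?s * (\<tau> * sqrt h2) = sqrt (h1 * h2 / (h1 + h2))"
    by (simp_all add: real_sqrt_mult[symmetric] mult.assoc[symmetric] mult_ac)
  then show "?c *\<^sub>R ((\<sigma> * sqrt h1) *\<^sub>R A) + ?s *\<^sub>R ((\<tau> * sqrt h2) *\<^sub>R B) = sqrt (h1 * h2 / (h1 + h2)) *\<^sub>R (A + B)"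
    unfolding scaleR_scaleR by (simp only: scaleR_add_right)
qed

lemma finite_vertex_pairs [simp]: "finite (vertex_pairs :: ('n::{finite,linorder} \<times> 'n) set)"
  by (rule finite_subset[OF subset_UNIV]) simp

text \<open>\<kappa> adds the direct edge, of conductance at least q = w / n, and n - 2 two-edge
  paths of conductance at least q / 2 each, so \<kappa> \<ge> w / 2. Only the direct edge
  distinguishes the two graphs, so \<kappa> and \<kappa>' differ by its change and \<open>u\<close>
  is shared.\<close>

lemma gram_law_neighbouring:
  fixes W W' :: "'n::{finite,linorder} weighting"
  assumes nbr: "neighbouring W W'" and w: "0 < w" "w / real CARD('n) < 1 / 2"
  obtains u and p0 :: "'n \<times> 'n" and b \<kappa> \<kappa>' where "p0 \<in> vertex_pairs" "w / 2 \<le> \<kappa>" "w / 2 \<le> \<kappa>'" "\<bar>\<kappa>' - \<kappa>\<bar> \<le> 1"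
    "jl_laplacian r w W = gram_law r vertex_pairs (u(p0 := sqrt \<kappa> *\<^sub>R b) \<circ> snd)"
    "jl_laplacian r w W' = gram_law r vertex_pairs (u(p0 := sqrt \<kappa>' *\<^sub>R b) \<circ> snd)"
proof -
  from nbr obtain a b where W: "weighted_graph W" "weighted_graph W'"
    and ab': "a \<noteq> b" "\<And>u v. {u, v} \<noteq> {a, b} \<Longrightarrow> W u v = W' u v"
    unfolding neighbouring_def by blast
  \<comment> \<open>The endpoints are ordered so that (a, b) itself indexes a row of the edge
    matrix.\<close>
  have "\<exists>a b. a < b \<and> (\<forall>u v. {u, v} \<noteq> {a, b} \<longrightarrow> W u v = W' u v)"
  proof (cases "a < b")
    case False
    then have "b < a" using ab' by simp
    then show ?thesis using ab'(2) by (intro exI[of _ b] exI[of _ a]) (simp add: insert_commute)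
  qed (use ab'(2) in blast)
  then obtain a b where ab: "a < b" and eq: "\<And>u v. {u, v} \<noteq> {a, b} \<Longrightarrow> W u v = W' u v" by blast
  define q where "q = w / real CARD('n)"
  have q: "0 < q" "q < 1 / 2" using w by (simp_all add: q_def)
  define H where "H = reweight w W"
  define H' where "H' = reweight w W'"
  have H_eq: "H u v = q + (1 - q) * W u v" "H' u v = q + (1 - q) * W' u v" if "u \<noteq> v" for u v
    using that by (simp_all add: H_def H'_def reweight_def q_def)
  have H_sym: "H u v = H v u" for u v
    using W(1) by (auto simp: H_def reweight_def weighted_graph_def)
  have W01: "0 \<le> W u v" "W u v \<le> 1" "0 \<le> W' u v" "W' u v \<le> 1" for u v
    using W by (auto simp: weighted_graph_def)
  have H_ge: "q \<le> H u v" "q \<le> H' u v" if "u \<noteq> v" for u v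
    using W01[of u v] q by (simp_all add: H_eq[OF that])
  let ?X = "UNIV - {a, b}" and ?p0 = "(a, b)"
  define d where "d = axis a (1::real) - axis b 1"
  define f where "f x = vertex_pair a x" for x
  define g where "g x = vertex_pair x b" for x
  \<comment> \<open>The series conductance of the path from a through x to b.\<close>
  define k where "k x = H a x * H x b / (H a x + H x b)" for x
  have p0: "?p0 = vertex_pair a b" using ab by (simp add: vertex_pair_def)
  have H_pos: "0 < H a x" "0 < H x b" if "x \<in> ?X" for x
    using H_ge(1)[of a x] H_ge(1)[of x b] q that by auto
  have k_ge: "q / 2 \<le> k x" if x: "x \<in> ?X" for x
  proof -
    have "0 \<le> (H a x - q) * H x b" "0 \<le> H a x * (H x b - q)"
      using H_ge(1)[of a x] H_ge(1)[of x b] H_pos[OF x] x by (auto intro!: mult_nonneg_nonneg)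
    \<comment> \<open>The sum of the two nonnegative products above, rearranged.\<close>
    then have "q * (H a x + H x b) \<le> 2 * (H a x * H x b)" by (simp add: algebra_simps)
    then show ?thesis using H_pos[OF x] by (simp add: k_def field_simps)
  qed
  have "\<exists>u. \<forall>h>0. gram_law r vertex_pairs ((edge_vector H)(?p0 := sqrt h *\<^sub>R d) \<circ> snd)
    = gram_law r vertex_pairs (u(?p0 := sqrt (h + sum k ?X) *\<^sub>R d) \<circ> snd)"
  proof (rule gram_law_series_parallel)
    show "?p0 \<in> vertex_pairs" using ab by (simp add: vertex_pairs_def)
    show "f ` ?X \<subseteq> vertex_pairs" "g ` ?X \<subseteq> vertex_pairs" by (auto simp: f_def g_def intro!: vertex_pair_mem)
    show "inj_on f ?X" "inj_on g ?X" "f ` ?X \<inter> g ` ?X = {}" "?p0 \<notin> f ` ?X" "?p0 \<notin> g ` ?X"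
      unfolding p0 using ab by (auto simp: f_def g_def inj_on_def vertex_pair_eq_iff doubleton_eq_iff)
    show "0 < k x" if "x \<in> ?X" for x using k_ge[OF that] q by linarith
    fix x assume x: "x \<in> ?X"
    obtain \<sigma> where \<sigma>: "\<sigma>\<^sup>2 = 1" "edge_vector H (f x) = (\<sigma> * sqrt (H a x)) *\<^sub>R (axis a 1 - axis x 1)"
      using edge_vector_vertex_pair[of H a x] H_sym x unfolding f_def by blast
    obtain \<tau> where \<tau>: "\<tau>\<^sup>2 = 1" "edge_vector H (g x) = (\<tau> * sqrt (H x b)) *\<^sub>R (axis x 1 - axis b 1)"
      using edge_vector_vertex_pair[of H x b] H_sym x unfolding g_def by blast
    \<comment> \<open>The direction d telescopes along the path.\<close>
    have "d = (axis a 1 - axis x 1) + (axis x 1 - axis b 1)" by (simp add: d_def)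
    then show "\<exists>c s. c\<^sup>2 + s\<^sup>2 = 1 \<and> c \<noteq> 0 \<and> c *\<^sub>R edge_vector H (f x) + s *\<^sub>R edge_vector H (g x) = sqrt (k x) *\<^sub>R d"
      unfolding \<sigma>(2) \<tau>(2) k_def by (simp only: series_rotation[OF H_pos[OF x] \<sigma>(1) \<tau>(1)])
  qed auto
  then obtain u where u: "\<And>h. 0 < h \<Longrightarrow> gram_law r vertex_pairs ((edge_vector H)(?p0 := sqrt h *\<^sub>R d) \<circ> snd)
    = gram_law r vertex_pairs (u(?p0 := sqrt (h + sum k ?X) *\<^sub>R d) \<circ> snd)" by blast
  have edge_p0: "edge_vector K ?p0 = sqrt (K a b) *\<^sub>R d" for K
    using ab by (auto simp: edge_vector_def edge_matrix_def d_def vec_eq_iff axis_def)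
  \<comment> \<open>Away from (a, b) both graphs have the same edge vectors, so the law for
    \<open>W'\<close> can be written with those of \<open>H\<close> and receives the same
    \<open>u\<close>.\<close>
  have "edge_vector H' p = edge_vector H p" if p: "p \<in> vertex_pairs" "p \<noteq> ?p0" for p
  proof -
    obtain x y where xy: "p = (x, y)" "x < y" using p by (auto simp: vertex_pairs_def)
    then have "{x, y} \<noteq> {a, b}" using p ab by (auto simp: doubleton_eq_iff)
    then have "H' x y = H x y" using xy by (simp add: H_eq eq)
    then show ?thesis by (simp add: xy edge_vector_def edge_matrix_def cong del: if_weak_cong)
  qed
  then have law': "jl_laplacian r w W' = gram_law r vertex_pairs ((edge_vector H)(?p0 := sqrt (H' a b) *\<^sub>R d) \<circ> snd)"
    unfolding jl_laplacian_eq_gram_law H'_def[symmetric]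
    by (intro gram_law_cong) (auto simp: edge_p0)
  have law: "jl_laplacian r w W = gram_law r vertex_pairs ((edge_vector H)(?p0 := sqrt (H a b) *\<^sub>R d) \<circ> snd)"
    unfolding jl_laplacian_eq_gram_law H_def[symmetric]
    by (intro gram_law_cong) (auto simp: edge_p0)
  have "card {a, b} \<le> CARD('n)" by (intro card_mono) auto
  then have n: "2 \<le> CARD('n)" using ab by simp
  then have "real (card ?X) = real CARD('n) - 2" using ab by (simp add: card_Diff_subset)
  moreover have "real (card ?X) * (q / 2) \<le> sum k ?X"
    using sum_bounded_below[of ?X "q / 2" k] k_ge by simp
  moreover have "(real CARD('n) - 2) * (q / 2) = w / 2 - q"
    using n by (simp add: q_def field_simps)
  ultimately have sum_k: "w / 2 - q \<le> sum k ?X" by simp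
  have ge: "q \<le> H a b" "q \<le> H' a b" using H_ge ab by auto
  then have pos: "0 < H a b" "0 < H' a b" using q by linarith+
  show thesis
  proof (rule that)
    show "?p0 \<in> vertex_pairs" using ab by (simp add: vertex_pairs_def)
    show "w / 2 \<le> H a b + sum k ?X" "w / 2 \<le> H' a b + sum k ?X" using sum_k ge by linarith+
    have "H' a b - H a b = (1 - q) * (W' a b - W a b)" using ab by (simp add: H_eq algebra_simps)
    moreover have "\<bar>W' a b - W a b\<bar> \<le> 1" using W01[of a b] by (simp add: abs_le_iff)
    ultimately have "\<bar>H' a b - H a b\<bar> \<le> 1" using q by (simp add: abs_mult mult_le_one)
    then show "\<bar>H' a b + sum k ?X - (H a b + sum k ?X)\<bar> \<le> 1" by simp
    show "jl_laplacian r w W = gram_law r vertex_pairs (u(?p0 := sqrt (H a b + sum k ?X) *\<^sub>R d) \<circ> snd)"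
      by (rule trans[OF law u[OF pos(1)]])
    show "jl_laplacian r w W' = gram_law r vertex_pairs (u(?p0 := sqrt (H' a b + sum k ?X) *\<^sub>R d) \<circ> snd)"
      by (rule trans[OF law' u[OF pos(2)]])
  qed
qed

theorem theorem2:
  fixes \<epsilon> \<delta> \<eta> \<nu> w :: real and r :: nat
  assumes "\<epsilon> > 0" and "\<delta> > 0" and "\<eta> > 0" and "\<nu> > 0"
    and "r = nat \<lceil>8 * ln (2 / \<nu>) / \<eta>\<^sup>2\<rceil>"
    and "w = sqrt (32 * real r * ln (2 / \<delta>)) / \<epsilon> * ln (4 * real r / \<delta>)"
    and "w / real CARD('n) < 1 / 2" and "1 / w < 1 / 2"
    and "\<epsilon> \<le> 16 * ln (2 / \<delta>) * (ln (4 * real r / \<delta>))\<^sup>2"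
  shows "differentially_private neighbouring \<epsilon> \<delta>
    (jl_laplacian r w :: 'n weighting \<Rightarrow> 'n::{finite,linorder} square_matrix measure)"
  unfolding differentially_private_def
proof (intro allI impI ballI)
  fix W W' :: "'n weighting" and S :: "'n square_matrix set"
  assume nbr: "neighbouring W W'" and S: "S \<in> sets borel"
  interpret P: prob_space "jl_laplacian r w W" by (rule prob_space_jl_laplacian)
  interpret P': prob_space "jl_laplacian r w W'" by (rule prob_space_jl_laplacian)
  \<comment> \<open>\<open>privacy_exponent\<close> needs \<delta> < 1 and r \<ge> 1. For \<delta>
    \<ge> 1 the claim holds because probabilities are at most 1.\<close>
  consider "1 \<le> \<delta>" | "r = 0" | "\<delta> < 1" "1 \<le> r" by linarith
  then show "measure (jl_laplacian r w W) S \<le> exp \<epsilon> * measure (jl_laplacian r w W') S + \<delta>"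
  proof cases
    case 1
    have "P.prob S \<le> 1" "0 \<le> exp \<epsilon> * P'.prob S" by simp_all
    with 1 show ?thesis by linarith
  next
    case 2
    \<comment> \<open>For r = 0 the factor 1 / real r is 0 by convention, so the output is the zero
      matrix whatever the graph.\<close>
    then have "jl_laplacian r w W = jl_laplacian r w W'"
      by (simp add: jl_laplacian_def sketched_laplacian_def)
    moreover have "1 * P'.prob S \<le> exp \<epsilon> * P'.prob S" using assms(1) by (intro mult_right_mono) auto
    ultimately show ?thesis using assms(2) by simp
  next
    case 3
    define t where "t = 3 * ln (1 / \<delta>) / \<epsilon>"
    note exponent = privacy_exponent[OF assms(1,2) 3 assms(6,9), folded t_def]
    obtain u b \<kappa> \<kappa>' and p0 :: "'n \<times> 'n" where p0: "p0 \<in> vertex_pairs"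
      and \<kappa>: "w / 2 \<le> \<kappa>" "w / 2 \<le> \<kappa>'" "\<bar>\<kappa>' - \<kappa>\<bar> \<le> 1"
      and law: "jl_laplacian r w W = gram_law r vertex_pairs (u(p0 := sqrt \<kappa> *\<^sub>R b) \<circ> snd)"
        "jl_laplacian r w W' = gram_law r vertex_pairs (u(p0 := sqrt \<kappa>' *\<^sub>R b) \<circ> snd)"
      using gram_law_neighbouring[OF nbr exponent(1) assms(7)] .
    \<comment> \<open>As \<kappa> and \<kappa>' differ by at most 1, this makes d = 2 / w a bound on
      their relative deviation with respect to either of them.\<close>
    have "1 \<le> 2 / w * \<kappa>" "1 \<le> 2 / w * \<kappa>'" "0 < \<kappa>" "0 < \<kappa>'"
      using \<kappa> exponent(1) by (simp_all add: field_simps)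
    then have renyi: "0 < 1 + t * (1 - \<kappa> / \<kappa>')"
        "- ln (1 + t * (1 - \<kappa> / \<kappa>')) - t * ln (\<kappa> / \<kappa>') \<le> t * (2 / w)\<^sup>2 / 2 + t\<^sup>2 * (2 / w)\<^sup>2"
      using renyi_exponent_le[of \<kappa> \<kappa>' "2 / w" t] \<kappa>(3) exponent(2,3) by auto
    let ?e = "- t * \<epsilon> + real r * ((- ln (1 + t * (1 - \<kappa> / \<kappa>')) - t * ln (\<kappa> / \<kappa>')) / 2)"
    have "real r * ((- ln (1 + t * (1 - \<kappa> / \<kappa>')) - t * ln (\<kappa> / \<kappa>')) / 2)
        \<le> real r * ((t * (2 / w)\<^sup>2 / 2 + t\<^sup>2 * (2 / w)\<^sup>2) / 2)"
      using renyi(2) by (intro mult_left_mono divide_right_mono) auto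
    then have "?e \<le> ln \<delta>" using exponent(4) by linarith
    then have e: "exp ?e \<le> \<delta>" using assms(2) by (metis exp_le_cancel_iff exp_ln)
    have "emeasure (jl_laplacian r w W) S \<le> exp \<epsilon> * emeasure (jl_laplacian r w W') S + exp ?e"
      unfolding law
      using p0 \<open>0 < \<kappa>\<close> \<open>0 < \<kappa>'\<close> exponent(2) renyi(1) S
      by (intro gram_law_le) auto
    then have "ennreal (P.prob S) \<le> ennreal (exp \<epsilon> * P'.prob S + exp ?e)"
      by (simp add: P.emeasure_eq_measure P'.emeasure_eq_measure ennreal_mult'[symmetric] ennreal_plus[symmetric] del: ennreal_plus)
    then have "P.prob S \<le> exp \<epsilon> * P'.prob S + exp ?e"
      by (subst (asm) ennreal_le_iff) auto
    then show ?thesis using e by linarith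
  qed
qed

end
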